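(* For each integer $n\ge 3$, there exist a compact connected $n$-dimensional spin manifold $X$ with nonempty smooth boundary $\partial X$ and a $1$-parameter family of Riemannian metrics $(g_a)_{a>0}$ on $X$ such that (i) the scalar curvature satisfies $\operatorname{scal}_{g_a}\equiv 0$ for every $a>0$; (ii) the Riemannian metric induced by $g_a$ on the boundary $\partial X$ is independent of $a$; (iii) $\int_{\partial X}H_{g_a}\to\infty$ as $a\to 0$; (iv) $\min_{\partial X}H_{g_a}\to-\infty$ as $a\to 0$. Moreover, if $n\ge 5$, then (i) can be replaced by the following condition, for any prescribed constant $C\in\mathbb{R}$: (i)' $\operatorname{scal}_{g_a}\equiv C$ for every $a>0$. That is, for every $n\ge5$ and every $C\in\mathbb{R}$ there exist a compact connected $n$-dimensional spin manifold $X$ with nonempty smooth boundary and a $1$-parameter family of Riemannian metrics $(g_a)_{a>0}$ on $X$ satisfying (i)', (ii), (iii) and (iv).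
   Context: $H_{g_a}$ denotes the unnormalized mean curvature (the trace of the second fundamental form) of $\partial X$ in $(X,g_a)$ with respect to the outward unit normal, with the sign convention that the boundary of a Euclidean ball of radius $r$ in $\mathbb{R}^n$ has mean curvature $(n-1)/r$. The integral over $\partial X$ is with respect to the Riemannian volume measure of the metric induced by $g_a$ on $\partial X$. $\operatorname{scal}_{g_a}$ is the scalar curvature of $(X,g_a)$. *)

theory Defs
  imports "HOL-Analysis.Analysis"
begin

section \<open>Smooth maps\<close>

(* Meant for open S. *)
primrec Ck_on :: "nat \<Rightarrow> ('a::euclidean_space \<Rightarrow> 'b::real_normed_vector) \<Rightarrow> 'a set \<Rightarrow> bool" where
  "Ck_on 0 f S \<longleftrightarrow> continuous_on S f"
| "Ck_on (Suc k) f S \<longleftrightarrow>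
     (\<forall>x\<in>S. f differentiable (at x)) \<and>
     (\<forall>v. Ck_on k (\<lambda>x. frechet_derivative f (at x) v) S)"

(* Smoothness on an arbitrary set, in the sense of local smooth extendability; this is what is
   needed on relatively open subsets of a half space. *)
definition smooth_on :: "('a::euclidean_space \<Rightarrow> 'b::real_normed_vector) \<Rightarrow> 'a set \<Rightarrow> bool" where
  "smooth_on f S \<longleftrightarrow>
     (\<forall>x\<in>S. \<exists>U F. open U \<and> x \<in> U \<and> (\<forall>k. Ck_on k F U) \<and> (\<forall>y\<in>U \<inter> S. F y = f y))"


section \<open>Smooth manifolds with boundary\<close>

(* The distinguished coordinate, which is nonnegative in all charts and vanishes exactly on the
   boundary. *)
definition nix :: "'n::finite" where
  "nix = (SOME i. True)"

definition half_space :: "(real^'n) set" where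
  "half_space = {x. 0 \<le> x $ nix}"

(* A chart is its domain together with its coordinate map. *)
type_synonym ('p, 'n) chart = "'p set \<times> ('p \<Rightarrow> real^'n)"

abbreviation cdom :: "('p, 'n::finite) chart \<Rightarrow> 'p set" where
  "cdom \<equiv> fst"

abbreviation coord :: "('p, 'n::finite) chart \<Rightarrow> 'p \<Rightarrow> real^'n" where
  "coord \<equiv> snd"

definition cimg :: "('p, 'n::finite) chart \<Rightarrow> (real^'n) set" where
  "cimg c = coord c ` cdom c"

definition param :: "('p, 'n::finite) chart \<Rightarrow> real^'n \<Rightarrow> 'p" where
  "param c = inv_into (cdom c) (coord c)"

definition is_chart :: "'p topology \<Rightarrow> ('p, 'n::finite) chart \<Rightarrow> bool" where
  "is_chart T c \<longleftrightarrow>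
     openin T (cdom c) \<and>
     openin (top_of_set half_space) (cimg c) \<and>
     homeomorphic_map (subtopology T (cdom c)) (top_of_set (cimg c)) (coord c)"

definition manifold_with_boundary :: "'p topology \<Rightarrow> ('p, 'n::finite) chart set \<Rightarrow> bool" where
  "manifold_with_boundary T A \<longleftrightarrow>
     Hausdorff_space T \<and> second_countable T \<and>
     (\<forall>c\<in>A. is_chart T c) \<and>
     (\<Union>c\<in>A. cdom c) = topspace T \<and>
     (\<forall>c\<in>A. \<forall>c'\<in>A. smooth_on (coord c' \<circ> param c) (coord c ` (cdom c \<inter> cdom c')))"

definition boundary :: "('p, 'n::finite) chart set \<Rightarrow> 'p set" where
  "boundary A = {p. \<exists>c\<in>A. p \<in> cdom c \<and> coord c p $ nix = 0}"

(* Jacobian matrix at p of the coordinate change from c to c'. Derivatives "within" a relatively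
   open subset of the half space are unique, also at boundary points. *)
definition jacobian :: "('p, 'n::finite) chart \<Rightarrow> ('p, 'n) chart \<Rightarrow> 'p \<Rightarrow> real^'n^'n" where
  "jacobian c c' p =
     matrix (frechet_derivative (coord c' \<circ> param c)
       (at (coord c p) within coord c ` (cdom c \<inter> cdom c')))"


section \<open>Riemannian metrics\<close>

(* Tensors on the manifold are given by their components in every chart, together with the
   transformation law. *)
type_synonym ('p, 'n) metric = "('p, 'n) chart \<Rightarrow> 'p \<Rightarrow> real^'n^'n"

definition riemannian_metric :: "('p, 'n::finite) chart set \<Rightarrow> ('p, 'n) metric \<Rightarrow> bool" where
  "riemannian_metric A g \<longleftrightarrow>
     (\<forall>c\<in>A. smooth_on (\<lambda>x. g c (param c x)) (cimg c)) \<and>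
     (\<forall>c\<in>A. \<forall>p\<in>cdom c. transpose (g c p) = g c p \<and> (\<forall>v. v \<noteq> 0 \<longrightarrow> v \<bullet> (g c p *v v) > 0)) \<and>
     (\<forall>c\<in>A. \<forall>c'\<in>A. \<forall>p\<in>cdom c \<inter> cdom c'.
        g c p = transpose (jacobian c c' p) ** g c' p ** jacobian c c' p)"

(* The functions below take a set S of coordinate values and the metric matrix h as a function of
   the coordinates on S. *)

definition partial :: "(real^'n) set \<Rightarrow> 'n::finite \<Rightarrow> (real^'n \<Rightarrow> real) \<Rightarrow> real^'n \<Rightarrow> real" where
  "partial S i F x = frechet_derivative F (at x within S) (axis i 1)"

(* christoffel S h k i j is the symbol with upper index k and lower indices i, j. *)
definition christoffel ::
    "(real^'n) set \<Rightarrow> (real^'n \<Rightarrow> real^'n^'n) \<Rightarrow> 'n::finite \<Rightarrow> 'n \<Rightarrow> 'n \<Rightarrow> real^'n \<Rightarrow> real" where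
  "christoffel S h k i j x =
     (\<Sum>l\<in>UNIV. matrix_inv (h x) $ k $ l *
        (partial S i (\<lambda>y. h y $ j $ l) x + partial S j (\<lambda>y. h y $ i $ l) x
          - partial S l (\<lambda>y. h y $ i $ j) x)) / 2"

(* riemann S h l k i j is the l-th component of R(d_i, d_j) d_k, where
   R(X,Y)Z = D_X D_Y Z - D_Y D_X Z - D_[X,Y] Z. *)
definition riemann ::
    "(real^'n) set \<Rightarrow> (real^'n \<Rightarrow> real^'n^'n) \<Rightarrow> 'n::finite \<Rightarrow> 'n \<Rightarrow> 'n \<Rightarrow> 'n \<Rightarrow> real^'n \<Rightarrow> real" where
  "riemann S h l k i j x =
     partial S i (christoffel S h l j k) x - partial S j (christoffel S h l i k) x +
     (\<Sum>m\<in>UNIV. christoffel S h l i m x * christoffel S h m j k x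
              - christoffel S h l j m x * christoffel S h m i k x)"

definition ricci ::
    "(real^'n) set \<Rightarrow> (real^'n \<Rightarrow> real^'n^'n) \<Rightarrow> 'n::finite \<Rightarrow> 'n \<Rightarrow> real^'n \<Rightarrow> real" where
  "ricci S h j k x = (\<Sum>l\<in>UNIV. riemann S h l k l j x)"

definition scal_coord :: "(real^'n) set \<Rightarrow> (real^'n \<Rightarrow> real^'n^'n) \<Rightarrow> real^'n::finite \<Rightarrow> real" where
  "scal_coord S h x = (\<Sum>j\<in>UNIV. \<Sum>k\<in>UNIV. matrix_inv (h x) $ j $ k * ricci S h j k x)"

(* Scalar and mean curvature do not depend on the chart in which they are computed. *)
definition chart_at :: "('p, 'n::finite) chart set \<Rightarrow> 'p \<Rightarrow> ('p, 'n) chart" where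
  "chart_at A p = (SOME c. c \<in> A \<and> p \<in> cdom c)"

definition scalar_curvature :: "('p, 'n::finite) chart set \<Rightarrow> ('p, 'n) metric \<Rightarrow> 'p \<Rightarrow> real" where
  "scalar_curvature A g p =
     (let c = chart_at A p in scal_coord (cimg c) (\<lambda>x. g c (param c x)) (coord c p))"


section \<open>Geometry of the boundary\<close>

(* Components of the metric induced on the boundary, with respect to the coordinates other than
   the distinguished one; the matrix is padded by a 1 on the diagonal to size n x n, so that its
   determinant and the tangential part of its inverse are those of the (n-1) x (n-1) block. *)
definition tangential :: "real^'n^'n \<Rightarrow> real^'n^'n::finite" where
  "tangential M = (\<chi> i j. if i = nix \<or> j = nix then (if i = j then 1 else 0) else M $ i $ j)"

definition boundary_metric :: "('p, 'n::finite) metric \<Rightarrow> ('p, 'n) metric" where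
  "boundary_metric g c p = tangential (g c p)"

(* M is the metric matrix at a boundary point; the inward side is that of positive nix-coordinate. *)
definition outward_unit_normal :: "real^'n^'n \<Rightarrow> real^'n::finite" where
  "outward_unit_normal M =
     (THE \<nu>. \<nu> \<bullet> (M *v \<nu>) = 1 \<and> (\<forall>w. w $ nix = 0 \<longrightarrow> w \<bullet> (M *v \<nu>) = 0) \<and> \<nu> $ nix < 0)"

(* g(D_i nu, d_j) = - g(nu, D_i d_j) for tangential i, j and the outward unit normal nu; positive
   for the Euclidean ball. *)
definition second_fundamental_form ::
    "(real^'n) set \<Rightarrow> (real^'n \<Rightarrow> real^'n^'n) \<Rightarrow> 'n::finite \<Rightarrow> 'n \<Rightarrow> real^'n \<Rightarrow> real" where
  "second_fundamental_form S h i j x =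
     - (outward_unit_normal (h x) \<bullet> (h x *v (\<chi> k. christoffel S h k i j x)))"

definition mean_curv_coord ::
    "(real^'n) set \<Rightarrow> (real^'n \<Rightarrow> real^'n^'n) \<Rightarrow> real^'n::finite \<Rightarrow> real" where
  "mean_curv_coord S h x =
     (\<Sum>i\<in>- {nix}. \<Sum>j\<in>- {nix}.
        matrix_inv (tangential (h x)) $ i $ j * second_fundamental_form S h i j x)"

definition mean_curvature :: "('p, 'n::finite) chart set \<Rightarrow> ('p, 'n) metric \<Rightarrow> 'p \<Rightarrow> real" where
  "mean_curvature A g p =
     (let c = chart_at A p in mean_curv_coord (cimg c) (\<lambda>x. g c (param c x)) (coord c p))"

(* (n-1)-dimensional Lebesgue measure on the hyperplane of vectors with vanishing nix-coordinate *)
definition hyperplane_lborel :: "(real^'n::finite) measure" where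
  "hyperplane_lborel =
     distr (\<Pi>\<^sub>M i\<in>- {nix}. lborel) borel (\<lambda>f. \<chi> i. if i = nix then 0 else f i)"

(* The Riemannian volume measure of the boundary: the unique Borel measure which in every chart
   has density sqrt(det) of the induced metric. *)
definition boundary_volume ::
    "'p topology \<Rightarrow> ('p, 'n::finite) chart set \<Rightarrow> ('p, 'n) metric \<Rightarrow> 'p measure" where
  "boundary_volume T A g =
     (THE \<mu>. space \<mu> = boundary A \<and>
        sets \<mu> = sigma_sets (boundary A) {U. openin (subtopology T (boundary A)) U} \<and>
        (\<forall>c\<in>A. \<forall>B\<in>sets \<mu>. B \<subseteq> cdom c \<longrightarrow>
           emeasure \<mu> B =
             (\<integral>\<^sup>+x. ennreal (sqrt (det (boundary_metric g c (param c x)))) * indicator (coord c ` B) x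
                \<partial>hyperplane_lborel)))"


section \<open>The spin group and spin manifolds\<close>

(* The Clifford algebra of Euclidean space with v v = - |v|^2. The basis element indexed by
   S = {i1 < ... < ik} is the product e_i1 ... e_ik, with respect to a fixed enumeration of the
   index type. *)
type_synonym 'n clifford = "real^('n set)"

(* Sign of the reordered product: one factor -1 for each inversion and one for each square e_i e_i. *)
definition cl_sign :: "'n::finite set \<Rightarrow> 'n set \<Rightarrow> real" where
  "cl_sign S T =
     (-1) ^ card {(i, j). i \<in> S \<and> j \<in> T \<and> to_nat_on (UNIV :: 'n set) j \<le> to_nat_on (UNIV :: 'n set) i}"

definition cl_mult :: "'n::finite clifford \<Rightarrow> 'n clifford \<Rightarrow> 'n clifford" where
  "cl_mult x y =
     (\<chi> R. \<Sum>S\<in>UNIV. \<Sum>T\<in>UNIV. if sym_diff S T = R then cl_sign S T * (x $ S) * (y $ T) else 0)"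

definition cl_one :: "'n::finite clifford" where
  "cl_one = axis {} 1"

definition cl_vec :: "real^'n::finite \<Rightarrow> 'n clifford" where
  "cl_vec v = (\<Sum>i\<in>UNIV. axis {i} (v $ i))"

inductive_set spin_group :: "'n::finite clifford set" where
  one: "cl_one \<in> spin_group"
| mult: "\<lbrakk>x \<in> spin_group; norm v = 1; norm w = 1\<rbrakk>
    \<Longrightarrow> cl_mult x (cl_mult (cl_vec v) (cl_vec w)) \<in> spin_group"

(* The double covering Spin(n) -> SO(n), sending x to the map v |-> x v x^(-1). *)
definition spin_cover :: "'n::finite clifford \<Rightarrow> real^'n^'n" where
  "spin_cover x = (THE M. \<forall>v. cl_mult x (cl_vec v) = cl_mult (cl_vec (M *v v)) x)"

(* Spin structure on (X,h) as a lift of an SO(n)-cocycle of the tangent bundle: U is an open cover,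
   e i is a continuous h-orthonormal frame over U i (e i c p is the matrix whose columns are the
   components of the frame vectors in the chart c), and the transition functions between these
   frames are the images of a continuous Spin(n)-valued cocycle s. In particular the frames define
   an orientation. *)
definition spin_structure ::
    "'p topology \<Rightarrow> ('p, 'n::finite) chart set \<Rightarrow> ('p, 'n) metric \<Rightarrow> (nat \<Rightarrow> 'p set) \<Rightarrow>
     (nat \<Rightarrow> ('p, 'n) chart \<Rightarrow> 'p \<Rightarrow> real^'n^'n) \<Rightarrow> (nat \<Rightarrow> nat \<Rightarrow> 'p \<Rightarrow> 'n clifford) \<Rightarrow> bool" where
  "spin_structure T A h U e s \<longleftrightarrow>
     (\<forall>i. openin T (U i)) \<and> (\<Union>i. U i) = topspace T \<and>
     (\<forall>i. \<forall>c\<in>A. continuous_map (subtopology T (U i \<inter> cdom c)) euclidean (e i c)) \<and>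
     (\<forall>i. \<forall>c\<in>A. \<forall>p\<in>U i \<inter> cdom c. transpose (e i c p) ** h c p ** e i c p = mat 1) \<and>
     (\<forall>i. \<forall>c\<in>A. \<forall>c'\<in>A. \<forall>p\<in>U i \<inter> cdom c \<inter> cdom c'. e i c' p = jacobian c c' p ** e i c p) \<and>
     (\<forall>i j. continuous_map (subtopology T (U i \<inter> U j)) euclidean (s i j)) \<and>
     (\<forall>i j. \<forall>p\<in>U i \<inter> U j. s i j p \<in> spin_group) \<and>
     (\<forall>i j. \<forall>c\<in>A. \<forall>p\<in>U i \<inter> U j \<inter> cdom c. e j c p = e i c p ** spin_cover (s i j p)) \<and>
     (\<forall>i j k. \<forall>p\<in>U i \<inter> U j \<inter> U k. cl_mult (s i j p) (s j k p) = s i k p)"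

(* Existence of a spin structure does not depend on the auxiliary metric. *)
definition spin_manifold :: "'p topology \<Rightarrow> ('p, 'n::finite) chart set \<Rightarrow> bool" where
  "spin_manifold T A \<longleftrightarrow>
     manifold_with_boundary T A \<and>
     (\<exists>h U e s. riemannian_metric A h \<and> spin_structure T A h U e s)"

end

theory Submission
  imports Defs "HOL-Complex_Analysis.Cauchy_Integral_Formula"
begin

text \<open>The manifold is the product of the interval from 1 to 2 with a flat torus, with the toroidal
  Schwarzschild--de Sitter metrics dr^2 / F(r) + r^2 dx^2, where F(r) = m / r^(n-2) - k r^2. Their
  scalar curvature is n (n - 1) k for every m, and m does not enter the induced metric on the
  boundary. With m = 1 / a^2 + 2^n |k| the function F is positive on the whole interval for every
  a > 0. The mean curvature is - (n - 1) sqrt (F 1) at the end r = 1 and (n - 1) sqrt (F 2) / 2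
  at the end r = 2, where the area is larger by the factor 2^(n-1). As m tends to infinity, the
  total mean curvature therefore grows like sqrt m times (n - 1) (sqrt (2^(n-2)) - 1) > 0, while its
  minimum tends to minus infinity.\<close>

section \<open>Diagonal metrics\<close>

text \<open>The torus is flat, so the scalar curvature of dr^2 / F(r) + r^2 dx^2 is (n - 1) (- F' /
  r - (n - 2) F / r^2), which is linear in F and of first order. The term - k r^2 produces the
  constant n (n - 1) k, and m / r^(n-2) spans the kernel, which makes m a free parameter. Since
  r^(n-2) F(r) = m - k r^n, the summand 2^n |k| of m outweighs k r^n on the interval and leaves at
  least 1 / a^2. The signs at the two ends differ because the outward normal points towards smaller
  r at r = 1.

  Each chart reaches one end only, and angles are defined up to multiples of 2 pi. With angles and
  the distance r - 1 or 2 - r as coordinates, every transition is locally a translation, combined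
  with a reversal of the radial direction between different ends. A matrix diag(a, b, ..., b) that
  depends on the point alone is therefore a tensor with the same components in all charts, and a
  global frame trivializes the spin structure. For the boundary volume, the point to settle is that
  the cut chosen for the angles has no effect.\<close>

definition diagm :: "real \<Rightarrow> real \<Rightarrow> real^'n^'n::finite" where
  "diagm a b = (\<chi> i j. if i = j then if i = nix then a else b else 0)"

lemma sum_single:
  fixes f :: "'a::finite \<Rightarrow> real"
  assumes "\<And>k. k \<noteq> i \<Longrightarrow> f k = 0"
  shows "(\<Sum>k\<in>UNIV. f k) = f i"
  using assms by (subst sum.remove[of _ i]) (auto intro!: sum.neutral)

lemma diagm_mult: "diagm a b ** diagm c d = (diagm (a * c) (b * d) :: real^'n^'n::finite)"
proof -
  have "(\<Sum>k\<in>UNIV. (diagm a b :: real^'n^'n) $ i $ k * (diagm c d :: real^'n^'n) $ k $ j) = diagm (a * c) (b * d) $ i $ j" for i j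
    by (subst sum_single[of i]) (auto simp: diagm_def)
  then show ?thesis by (simp add: matrix_matrix_mult_def vec_eq_iff)
qed

lemma diagm_one: "diagm 1 1 = mat 1"
  by (simp add: diagm_def mat_def vec_eq_iff)

lemma transpose_diagm: "transpose (diagm a b) = diagm a b"
  by (auto simp: diagm_def transpose_def vec_eq_iff)

lemma diagm_mult_vec: "diagm a b *v v = (\<chi> i. (if i = nix then a else b) * v $ i)"
proof -
  have "(\<Sum>k\<in>UNIV. diagm a b $ i $ k * v $ k) = (if i = nix then a else b) * v $ i" for i
    by (subst sum_single[of i]) (auto simp: diagm_def)
  then show ?thesis by (simp add: matrix_vector_mult_def vec_eq_iff)
qed

lemma matrix_inv_diagm:
  assumes "a \<noteq> 0" "b \<noteq> 0"
  shows "matrix_inv (diagm a b) = (diagm (1 / a) (1 / b) :: real^'n^'n::finite)"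
proof -
  let ?A = "diagm a b :: real^'n^'n" and ?B = "diagm (1 / a) (1 / b) :: real^'n^'n"
  have AB: "?A ** ?B = mat 1" "?B ** ?A = mat 1"
    using assms by (simp_all add: diagm_mult diagm_one)
  then have "matrix_inv ?A ** ?A = mat 1" 
    unfolding matrix_inv_def by (metis (mono_tags, lifting) someI_ex)
  then show ?thesis by (metis AB(1) matrix_mul_assoc matrix_mul_lid matrix_mul_rid)
qed

lemma sum_two:
  fixes f :: "'a::finite \<Rightarrow> real"
  assumes "i \<noteq> j" "\<And>k. k \<noteq> i \<Longrightarrow> k \<noteq> j \<Longrightarrow> f k = 0"
  shows "(\<Sum>k\<in>UNIV. f k) = f i + f j"
proof -
  have "(\<Sum>k\<in>UNIV. f k) = (\<Sum>k\<in>{i, j}. f k)"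
    by (rule sum.mono_neutral_right) (use assms in auto)
  then show ?thesis using assms(1) by simp
qed

lemma sum_nix:
  fixes f :: "'n::finite \<Rightarrow> real"
  shows "(\<Sum>i\<in>UNIV. f i) = f nix + (\<Sum>i\<in>- {nix}. f i)"
  by (subst sum.remove[of _ nix]) (auto simp: Compl_eq_Diff_UNIV)

lemma card_compl_nix: "card (- {nix :: 'n::finite}) = CARD('n) - 1"
  by (simp add: Compl_eq_Diff_UNIV card_Diff_singleton)

lemma det_diagm: "det (diagm a b :: real^'n^'n::finite) = a * b ^ (CARD('n) - 1)"
proof -
  have "det (diagm a b :: real^'n^'n) = (\<Prod>i\<in>UNIV. (diagm a b :: real^'n^'n) $ i $ i)"
    by (rule det_diagonal) (simp add: diagm_def)
  also have "\<dots> = a * (\<Prod>i\<in>UNIV - {nix :: 'n}. b)"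
    by (subst prod.remove[of _ nix]) (auto simp: diagm_def intro!: prod.cong)
  finally show ?thesis by (simp add: card_Diff_singleton)
qed

lemma tangential_diagm: "tangential (diagm a b) = diagm 1 b"
  by (auto simp: tangential_def diagm_def vec_eq_iff)

lemma diagm_quadratic_pos:
  fixes v :: "real^'n::finite"
  assumes "a > 0" "b > 0" "v \<noteq> 0"
  shows "v \<bullet> (diagm a b *v v) > 0"
proof -
  obtain k where k: "v $ k \<noteq> 0" using assms(3) by (auto simp: vec_eq_iff)
  have "(\<Sum>i\<in>UNIV. v $ i * ((if i = nix then a else b) * v $ i)) > 0"
  proof (rule sum_pos2[where i = k])
    show "v $ k * ((if k = nix then a else b) * v $ k) > 0"
      using k assms by (auto simp: zero_less_mult_iff mult_less_0_iff neq_iff)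
    show "0 \<le> v $ i * ((if i = nix then a else b) * v $ i)" for i
      using assms by (auto simp: zero_le_mult_iff mult_le_0_iff)
  qed auto
  then show ?thesis by (simp add: diagm_mult_vec inner_vec_def)
qed


section \<open>Smooth functions\<close>

text \<open>Openness of \<open>S\<close> makes the derivative at a point of \<open>S\<close> depend
  only on values on \<open>S\<close>, so equality passes from each level of the recursion to the
  next. The induction generalizes over \<open>f\<close> and \<open>g\<close> because it continues
  with their derivatives.\<close>

lemma Ck_on_cong:
  assumes "open S" "\<And>x. x \<in> S \<Longrightarrow> f x = g x" "Ck_on k f S"
  shows "Ck_on k g S"
  using assms(2,3)
proof (induction k arbitrary: f g)
  case 0
  then show ?case by (simp cong: continuous_on_cong)
next
  case (Suc k)
  have fd: "(g has_derivative frechet_derivative f (at x)) (at x)" if "x \<in> S" for x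
    using that Suc.prems assms(1)
    by (auto intro: has_derivative_transform_within_open[OF _ assms(1) that]
        simp: frechet_derivative_works)
  have "Ck_on k (\<lambda>x. frechet_derivative g (at x) v) S" for v
  proof (rule Suc.IH)
    show "Ck_on k (\<lambda>x. frechet_derivative f (at x) v) S" using Suc.prems by simp
    show "frechet_derivative f (at x) v = frechet_derivative g (at x) v" if "x \<in> S" for x
      using frechet_derivative_at[OF fd[OF that]] by simp
  qed
  then show ?case using fd by (auto simp: differentiable_def)
qed

lemma Ck_on_const: "open S \<Longrightarrow> Ck_on k (\<lambda>x. c) S"
proof (induction k arbitrary: c)
  case (Suc k)
  then show ?case by simp
qed simp

lemma Ck_on_affine:
  assumes "open S" "bounded_linear L"
  shows "Ck_on k (\<lambda>x. L x + c) S"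
proof (cases k)
  case 0
  then show ?thesis
    using linear_continuous_on[OF assms(2), of S] by (auto intro!: continuous_on_add)
next
  case (Suc j)
  have d: "((\<lambda>x. L x + c) has_derivative L) (at x)" for x
    using bounded_linear.has_derivative[OF assms(2) has_derivative_ident, of "at x"]
    by (auto intro!: derivative_eq_intros)
  have "frechet_derivative (\<lambda>x. L x + c) (at x) v = L v" for x v
    using frechet_derivative_at[OF d[of x]] by metis
  with Suc d Ck_on_const[OF assms(1)] show ?thesis by (auto simp: differentiable_def)
qed

text \<open>\<open>A\<close> and \<open>B\<close> list the successive derivatives of two functions
  of one variable. Differentiating in direction v moves \<open>j\<close> to \<open>Suc j\<close> and
  multiplies the fixed vectors \<open>U\<close> and \<open>V\<close> by the i-th entry of v, so the
  family is closed under differentiation. With constant matrices for \<open>U\<close> and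
  \<open>V\<close> it contains the metrics used below.\<close>

lemma Ck_on_compose_component:
  fixes A B :: "nat \<Rightarrow> real \<Rightarrow> real" and U V :: "'a::real_normed_vector" and i :: "'n::finite"
  assumes S: "open S"
    and A: "\<And>j y. y \<in> S \<Longrightarrow> (A j has_real_derivative A (Suc j) (y $ i)) (at (y $ i))"
    and B: "\<And>j y. y \<in> S \<Longrightarrow> (B j has_real_derivative B (Suc j) (y $ i)) (at (y $ i))"
  shows "Ck_on k (\<lambda>y::real^'n. A j (y $ i) *\<^sub>R U + B j (y $ i) *\<^sub>R V) S"
proof (induction k arbitrary: j U V)
  case (0 j U V)
  have "isCont (\<lambda>y::real^'n. A j (y $ i)) y" "isCont (\<lambda>y::real^'n. B j (y $ i)) y" if "y \<in> S" for y
    using isCont_o2[where f = "\<lambda>y. y $ i" and g = "A j", OF _ DERIV_isCont[OF A[OF that]]]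
      isCont_o2[where f = "\<lambda>y. y $ i" and g = "B j", OF _ DERIV_isCont[OF B[OF that]]]
    by (auto intro!: continuous_intros)
  then show ?case
    by (auto intro!: continuous_at_imp_continuous_on continuous_intros)
next
  case (Suc k j U V)
  have comp: "((\<lambda>y::real^'n. G j (y $ i)) has_derivative (\<lambda>v. v $ i * G (Suc j) (y $ i))) (at y)"
    if "(G j has_real_derivative G (Suc j) (y $ i)) (at (y $ i))" for y G
  proof -
    have "((\<lambda>y::real^'n. y $ i) has_derivative (\<lambda>v. v $ i)) (at y)"
      by (rule bounded_linear_imp_has_derivative[OF bounded_linear_vec_nth])
    moreover have "(G j has_derivative (\<lambda>t. G (Suc j) (y $ i) * t)) (at (y $ i))"
      using that by (simp add: has_field_derivative_def)
    ultimately show ?thesis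
      using has_derivative_compose[where f = "\<lambda>y::real^'n. y $ i" and g = "G j"] by (fastforce simp: mult.commute)
  qed
  have d: "((\<lambda>y::real^'n. A j (y $ i) *\<^sub>R U + B j (y $ i) *\<^sub>R V) has_derivative
      (\<lambda>v. (v $ i * A (Suc j) (y $ i)) *\<^sub>R U + (v $ i * B (Suc j) (y $ i)) *\<^sub>R V)) (at y)"
    if "y \<in> S" for y
    by (intro has_derivative_add has_derivative_scaleR_left comp A B that)
  have "Ck_on k (\<lambda>y. frechet_derivative (\<lambda>y::real^'n. A j (y $ i) *\<^sub>R U + B j (y $ i) *\<^sub>R V) (at y) v) S" for v
  proof (rule Ck_on_cong[OF S _ Suc.IH[of "Suc j" "v $ i *\<^sub>R U" "v $ i *\<^sub>R V"]])
    fix y assume "y \<in> S"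
    show "A (Suc j) (y $ i) *\<^sub>R v $ i *\<^sub>R U + B (Suc j) (y $ i) *\<^sub>R v $ i *\<^sub>R V =
      frechet_derivative (\<lambda>y. A j (y $ i) *\<^sub>R U + B j (y $ i) *\<^sub>R V) (at y) v"
      using fun_cong[OF frechet_derivative_at[OF d[OF \<open>y \<in> S\<close>]], of v] by (simp add: mult.commute)
  qed
  then show ?case using d by (auto simp: differentiable_def)
qed

text \<open>A source of such derivative sequences without computing them: a holomorphic function has
  all complex derivatives, and on the real axis their real parts are successive real derivatives of
  one another.\<close>

lemma real_part_higher_deriv:
  assumes "f holomorphic_on S" "open S" "complex_of_real t \<in> S"
  shows "((\<lambda>t. Re ((deriv ^^ k) f (of_real t))) has_real_derivative
           Re ((deriv ^^ Suc k) f (of_real t))) (at t)"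
proof -
  have "((deriv ^^ k) f has_field_derivative (deriv ^^ Suc k) f (of_real t)) (at (of_real t))"
    using holomorphic_derivI[OF holomorphic_higher_deriv[OF assms(1,2)] assms(2,3)] by simp
  then have "((\<lambda>t. (deriv ^^ k) f (of_real t)) has_vector_derivative (deriv ^^ Suc k) f (of_real t)) (at t)"
    by (rule has_vector_derivative_real_field)
  then have "((\<lambda>t. Re ((deriv ^^ k) f (of_real t))) has_vector_derivative Re ((deriv ^^ Suc k) f (of_real t))) (at t)"
    by (rule bounded_linear.has_vector_derivative[OF bounded_linear_Re])
  then show ?thesis by (simp add: has_real_derivative_iff_has_vector_derivative)
qed


section \<open>Derivatives on relatively open subsets of the half space\<close>

text \<open>A derivative within a set is unique if the set contains arbitrarily small displacements
  along each basis vector. In the half space positive displacements will do, also at boundary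
  points, since they never decrease the distinguished coordinate.\<close>

lemma frechet_derivative_half_space:
  fixes x :: "real^'n::finite"
  assumes S: "openin (top_of_set half_space) S" "x \<in> S"
    and f: "(f has_derivative D) (at x within S)"
  shows "frechet_derivative f (at x within S) = D"
proof (rule frechet_derivative_unique_within[OF _ f])
  show "(f has_derivative frechet_derivative f (at x within S)) (at x within S)"
    using f by (meson differentiableI frechet_derivative_works)
next
  fix b :: "real^'n" and e :: real
  assume b: "b \<in> Basis" and e: "e > 0"
  obtain i where i: "b = axis i 1" using b by (auto simp: Basis_vec_def)
  obtain d where d: "d > 0" "\<And>y. y \<in> half_space \<Longrightarrow> dist y x < d \<Longrightarrow> y \<in> S"
    using S unfolding openin_euclidean_subtopology_iff by blast
  \<comment> \<open>Below \<open>e\<close> as uniqueness demands, and below \<open>d\<close> so that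
    the displaced point stays in \<open>S\<close>.\<close>
  let ?t = "min e d / 2"
  have "x + ?t *\<^sub>R b \<in> S"
  proof (rule d(2))
    have "x \<in> half_space" using S by (auto dest: openin_imp_subset)
    then show "x + ?t *\<^sub>R b \<in> half_space"
      using e d(1) by (simp add: half_space_def i axis_def)
    show "dist (x + ?t *\<^sub>R b) x < d" using e d(1) b by (simp add: dist_norm)
  qed
  then show "\<exists>t. 0 < \<bar>t\<bar> \<and> \<bar>t\<bar> < e \<and> x + t *\<^sub>R b \<in> S"
    using e d(1) by (intro exI[of _ ?t]) auto
qed

text \<open>All functions differentiated below depend on the distinguished coordinate alone. The
  one-variable function \<open>\<phi>\<close> is differentiable on both sides of the point, whereas
  \<open>F\<close> is compared with it on \<open>S\<close> only.\<close>

lemma partial_component: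
  fixes x :: "real^'n::finite"
  assumes S: "openin (top_of_set half_space) S" "x \<in> S"
    and F: "\<And>y. y \<in> S \<Longrightarrow> F y = \<phi> (y $ nix)"
    and d: "(\<phi> has_real_derivative \<phi>') (at (x $ nix))"
  shows "partial S i F x = (if i = nix then \<phi>' else 0)"
proof -
  have "((\<lambda>y. \<phi> (y $ nix)) has_derivative (\<lambda>v. \<phi>' * v $ nix)) (at x within S)"
  proof -
    have "((\<lambda>y. y $ nix) has_derivative (\<lambda>v. v $ nix)) (at x within S)"
      by (rule bounded_linear_imp_has_derivative[OF bounded_linear_vec_nth])
    moreover have "(\<phi> has_derivative (\<lambda>t. \<phi>' * t)) (at (x $ nix))"
      using d by (simp add: has_field_derivative_def)
    ultimately show ?thesis
      using has_derivative_compose[where f = "\<lambda>y. y $ nix" and g = \<phi>] by fastforce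
  qed
  then have "(F has_derivative (\<lambda>v. \<phi>' * v $ nix)) (at x within S)"
    using S(2) F by (auto intro: has_derivative_transform)
  from frechet_derivative_half_space[OF S this] show ?thesis
    by (simp add: partial_def axis_def)
qed


section \<open>Curvature of a warped product metric\<close>

text \<open>The pattern of the Christoffel symbols of diag(\<alpha>(t), \<beta>(t), ...,
  \<beta>(t)): with t for the distinguished index and i for any other, \<open>P\<close> is the
  symbol with upper t and lower t t, \<open>Q\<close> the one with upper t and lower i i, and
  \<open>R\<close> the one with upper i and lower t i or i t.\<close>

definition warped_christoffel :: "real \<Rightarrow> real \<Rightarrow> real \<Rightarrow> 'n::finite \<Rightarrow> 'n \<Rightarrow> 'n \<Rightarrow> real" where
  "warped_christoffel P Q R k i j =
     (if k = nix then if i = nix \<and> j = nix then P else if i = j then Q else 0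
      else if (i = nix \<and> j = k) \<or> (j = nix \<and> i = k) then R else 0)"

context
  fixes S :: "(real^'n::finite) set" and h :: "real^'n \<Rightarrow> real^'n^'n"
    and \<alpha> \<beta> \<alpha>' \<beta>' :: "real \<Rightarrow> real"
  assumes S: "openin (top_of_set half_space) S"
    and h: "\<And>x. x \<in> S \<Longrightarrow> h x = diagm (\<alpha> (x $ nix)) (\<beta> (x $ nix))"
    and pos: "\<And>x. x \<in> S \<Longrightarrow> \<alpha> (x $ nix) > 0" "\<And>x. x \<in> S \<Longrightarrow> \<beta> (x $ nix) > 0"
    and d\<alpha>: "\<And>x. x \<in> S \<Longrightarrow> (\<alpha> has_real_derivative \<alpha>' (x $ nix)) (at (x $ nix))"
    and d\<beta>: "\<And>x. x \<in> S \<Longrightarrow> (\<beta> has_real_derivative \<beta>' (x $ nix)) (at (x $ nix))"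
begin

lemma partial_warped:
  assumes "x \<in> S"
  shows "partial S l (\<lambda>y. h y $ i $ j) x =
    (if l = nix \<and> i = j then if i = nix then \<alpha>' (x $ nix) else \<beta>' (x $ nix) else 0)"
proof -
  have "((\<lambda>t. if i = j then if i = nix then \<alpha> t else \<beta> t else 0) has_real_derivative
      (if i = j then if i = nix then \<alpha>' (x $ nix) else \<beta>' (x $ nix) else 0)) (at (x $ nix))"
    using d\<alpha>[OF assms] d\<beta>[OF assms] by auto
  from partial_component[OF S assms _ this] show ?thesis by (auto simp: h diagm_def)
qed

lemma christoffel_warped:
  assumes x: "x \<in> S"
  shows "christoffel S h k i j x =
    warped_christoffel (\<alpha>' (x $ nix) / (2 * \<alpha> (x $ nix))) (- \<beta>' (x $ nix) / (2 * \<alpha> (x $ nix)))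
      (\<beta>' (x $ nix) / (2 * \<beta> (x $ nix))) k i j"
proof -
  have inv: "matrix_inv (h x) = diagm (1 / \<alpha> (x $ nix)) (1 / \<beta> (x $ nix))"
    using pos[OF x] by (simp add: h[OF x] matrix_inv_diagm)
  have "christoffel S h k i j x = (matrix_inv (h x) $ k $ k *
        (partial S i (\<lambda>y. h y $ j $ k) x + partial S j (\<lambda>y. h y $ i $ k) x
          - partial S k (\<lambda>y. h y $ i $ j) x)) / 2"
    unfolding christoffel_def by (subst sum_single[of k]) (auto simp: inv diagm_def)
  then show ?thesis
    using pos[OF x]
    by (auto simp: inv diagm_def partial_warped[OF x] warped_christoffel_def)
qed

context
  fixes P Q R P' Q' R' :: "real \<Rightarrow> real"
  assumes P: "\<And>x. x \<in> S \<Longrightarrow> \<alpha>' (x $ nix) = 2 * \<alpha> (x $ nix) * P (x $ nix)"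
    and Q: "\<And>x. x \<in> S \<Longrightarrow> \<beta>' (x $ nix) = - 2 * \<alpha> (x $ nix) * Q (x $ nix)"
    and R: "\<And>x. x \<in> S \<Longrightarrow> \<beta>' (x $ nix) = 2 * \<beta> (x $ nix) * R (x $ nix)"
    and dP: "\<And>x. x \<in> S \<Longrightarrow> (P has_real_derivative P' (x $ nix)) (at (x $ nix))"
    and dQ: "\<And>x. x \<in> S \<Longrightarrow> (Q has_real_derivative Q' (x $ nix)) (at (x $ nix))"
    and dR: "\<And>x. x \<in> S \<Longrightarrow> (R has_real_derivative R' (x $ nix)) (at (x $ nix))"
begin

text \<open>The three symbols enter as functions with derivatives of their own, tied to \<alpha>'
  and \<beta>' by equations without denominators. Curvature can then be computed without second
  derivatives of \<alpha> and \<beta>.\<close>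

lemma christoffel_warped':
  assumes x: "x \<in> S"
  shows "christoffel S h k i j x = warped_christoffel (P (x $ nix)) (Q (x $ nix)) (R (x $ nix)) k i j"
proof -
  have "\<alpha>' (x $ nix) / (2 * \<alpha> (x $ nix)) = P (x $ nix)"
       "- \<beta>' (x $ nix) / (2 * \<alpha> (x $ nix)) = Q (x $ nix)"
       "\<beta>' (x $ nix) / (2 * \<beta> (x $ nix)) = R (x $ nix)"
    using pos[OF x] R[OF x] by (simp_all add: P[OF x] Q[OF x] field_simps)
  then show ?thesis by (simp add: christoffel_warped[OF x])
qed

lemma partial_christoffel_warped:
  assumes x: "x \<in> S"
  shows "partial S l (christoffel S h k i j) x =
    (if l = nix then warped_christoffel (P' (x $ nix)) (Q' (x $ nix)) (R' (x $ nix)) k i j else 0)"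
proof -
  have "((\<lambda>t. warped_christoffel (P t) (Q t) (R t) k i j) has_real_derivative
      warped_christoffel (P' (x $ nix)) (Q' (x $ nix)) (R' (x $ nix)) k i j) (at (x $ nix))"
    using dP[OF x] dQ[OF x] dR[OF x] by (auto simp: warped_christoffel_def)
  from partial_component[OF S x _ this] show ?thesis by (simp add: christoffel_warped')
qed

text \<open>The n - 1 tangential directions contribute equal radial curvatures, and the radial
  direction contributes 0.\<close>

lemma ricci_warped_nix:
  assumes x: "x \<in> S"
  shows "ricci S h nix nix x = (real CARD('n) - 1) *
    (- R' (x $ nix) + R (x $ nix) * P (x $ nix) - R (x $ nix) ^ 2)"
proof -
  have "riemann S h l nix l nix x =
      (if l = nix then 0 else - R' (x $ nix) + R (x $ nix) * P (x $ nix) - R (x $ nix) ^ 2)" for l :: 'n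
  proof (cases "l = nix")
    case True
    then show ?thesis
      unfolding riemann_def christoffel_warped'[OF x] partial_christoffel_warped[OF x]
      by (subst sum_single[of nix]) (auto simp: warped_christoffel_def)
  next
    case False
    then show ?thesis
      unfolding riemann_def christoffel_warped'[OF x] partial_christoffel_warped[OF x]
      by (subst sum_two[of nix l]) (auto simp: warped_christoffel_def power2_eq_square)
  qed
  then show ?thesis
    unfolding ricci_def sum_nix by (simp add: card_compl_nix of_nat_diff)
qed

text \<open>The radial direction contributes Q' + P Q - Q R, the direction \<open>j\<close> itself
  nothing, and each of the n - 2 remaining ones Q R. The coefficient n - 3 is the balance of n - 2
  and - 1.\<close>

lemma ricci_warped_other:
  assumes x: "x \<in> S" and j: "j \<noteq> nix"
  shows "ricci S h j j x =
    Q' (x $ nix) + P (x $ nix) * Q (x $ nix) + (real CARD('n) - 3) * Q (x $ nix) * R (x $ nix)"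
proof -
  have 1: "riemann S h nix j nix j x = Q' (x $ nix) + P (x $ nix) * Q (x $ nix) - Q (x $ nix) * R (x $ nix)"
    using j unfolding riemann_def christoffel_warped'[OF x] partial_christoffel_warped[OF x]
    by (subst sum_two[of nix j]) (auto simp: warped_christoffel_def)
  have 2: "riemann S h l j l j x = (if l = j then 0 else Q (x $ nix) * R (x $ nix))"
    if "l \<noteq> nix" for l
  proof (cases "l = j")
    case True
    then show ?thesis by (simp add: riemann_def)
  next
    case False
    with j that show ?thesis
      unfolding riemann_def christoffel_warped'[OF x] partial_christoffel_warped[OF x]
      by (subst sum_single[of nix]) (auto simp: warped_christoffel_def)
  qed
  have "(\<Sum>l\<in>- {nix}. riemann S h l j l j x) = (\<Sum>l\<in>- {nix} - {j}. Q (x $ nix) * R (x $ nix))"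
    using j by (subst sum.remove[of _ j]) (auto simp: 2 intro!: sum.cong)
  also have "\<dots> = (real CARD('n) - 2) * (Q (x $ nix) * R (x $ nix))"
  proof -
    have "card {nix, j} \<le> CARD('n)" by (rule card_mono) auto
    then have "CARD('n) \<ge> 2" using j by simp
    then show ?thesis using j by (simp add: card_compl_nix card_Diff_singleton of_nat_diff)
  qed
  finally show ?thesis unfolding ricci_def sum_nix by (simp add: 1 algebra_simps)
qed

lemma scal_warped:
  assumes x: "x \<in> S"
  shows "scal_coord S h x = (real CARD('n) - 1) *
    ((- R' (x $ nix) + R (x $ nix) * P (x $ nix) - R (x $ nix) ^ 2) / \<alpha> (x $ nix) +
     (Q' (x $ nix) + P (x $ nix) * Q (x $ nix) + (real CARD('n) - 3) * Q (x $ nix) * R (x $ nix))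
       / \<beta> (x $ nix))"
proof -
  have inv: "matrix_inv (h x) = diagm (1 / \<alpha> (x $ nix)) (1 / \<beta> (x $ nix))"
    using pos[OF x] by (simp add: h[OF x] matrix_inv_diagm)
  have "scal_coord S h x = (\<Sum>j\<in>UNIV. matrix_inv (h x) $ j $ j * ricci S h j j x)"
    unfolding scal_coord_def
  proof (rule sum.cong[OF refl])
    fix j :: 'n
    show "(\<Sum>k\<in>UNIV. matrix_inv (h x) $ j $ k * ricci S h j k x) = matrix_inv (h x) $ j $ j * ricci S h j j x"
      by (subst sum_single[of j]) (auto simp: inv diagm_def)
  qed
  also have "\<dots> = ricci S h nix nix x / \<alpha> (x $ nix) +
      (\<Sum>j\<in>- {nix}. ricci S h j j x / \<beta> (x $ nix))"
    unfolding sum_nix by (auto simp: inv diagm_def intro!: sum.cong)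
  also have "(\<Sum>j\<in>- {nix}. ricci S h j j x / \<beta> (x $ nix)) = (real CARD('n) - 1) *
      ((Q' (x $ nix) + P (x $ nix) * Q (x $ nix) + (real CARD('n) - 3) * Q (x $ nix) * R (x $ nix))
        / \<beta> (x $ nix))"
    by (simp add: ricci_warped_other[OF x] card_compl_nix of_nat_diff)
  finally show ?thesis unfolding ricci_warped_nix[OF x] by (simp add: algebra_simps)
qed

text \<open>Orthogonality to the coordinate axes leaves only the radial entry of the normal, its
  length fixes this entry up to sign, and outwardness makes it - 1 / sqrt \<alpha>. Pairing with it
  turns the symbol \<open>Q\<close> into sqrt \<alpha> times \<open>Q\<close>, and the trace
  multiplies by (n - 1) / \<beta>. The result is negative where \<beta> grows inwards.\<close>

lemma mean_curv_warped:
  assumes x: "x \<in> S"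
  shows "mean_curv_coord S h x =
    (real CARD('n) - 1) * sqrt (\<alpha> (x $ nix)) * Q (x $ nix) / \<beta> (x $ nix)"
proof -
  define a b where "a = \<alpha> (x $ nix)" and "b = \<beta> (x $ nix)"
  have ab: "a > 0" "b > 0" using pos[OF x] by (simp_all add: a_def b_def)
  have hx: "h x = diagm a b" by (simp add: h[OF x] a_def b_def)
  have nu: "outward_unit_normal (h x) = axis nix (- 1 / sqrt a)"
    unfolding outward_unit_normal_def
  proof (rule the_equality)
    show "axis nix (- 1 / sqrt a) \<bullet> (h x *v axis nix (- 1 / sqrt a)) = 1 \<and>
      (\<forall>w. w $ nix = 0 \<longrightarrow> w \<bullet> (h x *v axis nix (- 1 / sqrt a)) = 0) \<and> axis nix (- 1 / sqrt a) $ nix < 0"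
    proof -
      have "h x *v axis nix (- 1 / sqrt a) = axis nix (- sqrt a)"
        using ab by (auto simp: hx diagm_mult_vec axis_def vec_eq_iff real_div_sqrt)
      then show ?thesis using ab by (simp add: inner_axis' inner_axis)
    qed
  next
    fix \<nu> :: "real^'n"
    assume \<nu>: "\<nu> \<bullet> (h x *v \<nu>) = 1 \<and> (\<forall>w. w $ nix = 0 \<longrightarrow> w \<bullet> (h x *v \<nu>) = 0) \<and> \<nu> $ nix < 0"
    have z: "\<nu> $ i = 0" if "i \<noteq> nix" for i
    proof -
      have "axis i 1 \<bullet> (h x *v \<nu>) = 0" using \<nu> that by (simp add: axis_def)
      then show ?thesis using that ab by (simp add: hx diagm_mult_vec inner_axis')
    qed
    then have e: "\<nu> = axis nix (\<nu> $ nix)" by (auto simp: vec_eq_iff axis_def)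
    have "a * (\<nu> $ nix)\<^sup>2 = 1"
      using \<nu> by (subst (asm) (1) e) (simp add: hx diagm_mult_vec inner_axis' power2_eq_square mult_ac)
    then have "(\<nu> $ nix)\<^sup>2 = (1 / sqrt a)\<^sup>2" using ab by (simp add: power_divide field_simps)
    then have "\<nu> $ nix = 1 / sqrt a \<or> \<nu> $ nix = - (1 / sqrt a)" by (simp only: power2_eq_iff)
    moreover have "1 / sqrt a > 0" using ab by simp
    ultimately have "\<nu> $ nix = - 1 / sqrt a" using \<nu> by auto
    then show "\<nu> = axis nix (- 1 / sqrt a)" using e by simp
  qed
  have sff: "second_fundamental_form S h i j x = sqrt a * christoffel S h nix i j x" for i j
  proof -
    have "second_fundamental_form S h i j x = a / sqrt a * christoffel S h nix i j x"
      by (simp add: second_fundamental_form_def nu[unfolded hx] inner_axis' hx diagm_mult_vec)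
    then show ?thesis using ab by (simp add: real_div_sqrt)
  qed
  have inv: "matrix_inv (tangential (h x)) = diagm 1 (1 / b)"
    using ab by (simp add: hx tangential_diagm matrix_inv_diagm)
  have "mean_curv_coord S h x = (\<Sum>i\<in>- {nix :: 'n}. sqrt a * Q (x $ nix) / b)"
    unfolding mean_curv_coord_def inv sff christoffel_warped'[OF x]
  proof (rule sum.cong[OF refl])
    fix i :: 'n assume i: "i \<in> - {nix}"
    show "(\<Sum>j\<in>- {nix}. diagm 1 (1 / b) $ i $ j * (sqrt a *
        warped_christoffel (P (x $ nix)) (Q (x $ nix)) (R (x $ nix)) nix i j)) = sqrt a * Q (x $ nix) / b"
      using i by (subst sum.remove[of _ i]) (auto simp: diagm_def warped_christoffel_def intro!: sum.neutral)
  qed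
  then show ?thesis by (simp add: card_compl_nix of_nat_diff a_def b_def)
qed

end

end


section \<open>The product of an interval and a torus\<close>

definition ix :: "'n::finite \<Rightarrow> nat" where
  "ix = to_nat_on UNIV"

lemma inj_ix: "inj (ix :: 'n::finite \<Rightarrow> nat)"
  unfolding ix_def by (rule inj_on_to_nat_on) simp

text \<open>The type of points is \<open>nat \<Rightarrow> real\<close> in every dimension, so a
  tuple of complex numbers is stored as a sequence: real parts at even and imaginary parts at odd
  positions, and 0 at positions that belong to no index.\<close>

definition emb :: "('n::finite \<Rightarrow> complex) \<Rightarrow> nat \<Rightarrow> real" where
  "emb z m =
     (if m div 2 \<in> range (ix :: 'n \<Rightarrow> nat)
      then if even m then Re (z (inv ix (m div 2))) else Im (z (inv ix (m div 2))) else 0)"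

definition cpt :: "(nat \<Rightarrow> real) \<Rightarrow> 'n::finite \<Rightarrow> complex" where
  "cpt p i = Complex (p (2 * ix i)) (p (2 * ix i + 1))"

lemma cpt_emb [simp]: "cpt (emb z) i = z i"
  by (simp add: cpt_def emb_def inv_f_f[OF inj_ix])

lemma continuous_emb:
  fixes f :: "'a::topological_space \<Rightarrow> 'n::finite \<Rightarrow> complex"
  assumes "\<And>i. continuous_on A (\<lambda>x. f x i)"
  shows "continuous_on A (\<lambda>x. emb (f x))"
proof (rule continuous_on_coordinatewise_then_product)
  fix m show "continuous_on A (\<lambda>x. emb (f x) m)"
    unfolding emb_def
    by (cases "even m"; cases "m div 2 \<in> range (ix :: 'n \<Rightarrow> nat)")
      (simp_all add: assms continuous_on_Re continuous_on_Im del: range_eqI rangeI)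
qed

lemma continuous_cpt: "continuous_on A (\<lambda>p. cpt p i)"
  unfolding cpt_def Complex_eq
  by (intro continuous_intros continuous_on_of_real continuous_on_product_then_coordinatewise continuous_on_id)

definition slab :: "('n::finite \<Rightarrow> complex) set" where
  "slab = {z. Im (z nix) = 0 \<and> 1 \<le> Re (z nix) \<and> Re (z nix) \<le> 2 \<and> (\<forall>i. i \<noteq> nix \<longrightarrow> cmod (z i) = 1)}"

definition slab_points :: "'n::finite itself \<Rightarrow> (nat \<Rightarrow> real) set" where
  "slab_points _ = emb ` (slab :: ('n \<Rightarrow> complex) set)"

definition slab_top :: "'n::finite itself \<Rightarrow> (nat \<Rightarrow> real) topology" where
  "slab_top t = top_of_set (slab_points t)"

text \<open>The chart with index S is adapted to the end 1 of the interval if S contains the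
  distinguished index, and to the end 2 otherwise; its i-th angle runs from pi to 3 pi or from 0
  to 2 pi according to whether i is in S.\<close>

definition base :: "'n::finite set \<Rightarrow> real" where
  "base S = (if nix \<in> S then 1 else 2)"

definition eps :: "'n::finite set \<Rightarrow> real" where
  "eps S = (if nix \<in> S then 1 else - 1)"

definition shift :: "'n set \<Rightarrow> 'n \<Rightarrow> real" where
  "shift S i = (if i \<in> S then pi else 0)"

definition wrap :: "'n::finite set \<Rightarrow> real^'n \<Rightarrow> 'n \<Rightarrow> complex" where
  "wrap S x i = (if i = nix then of_real (base S + eps S * x $ nix) else cis (x $ i))"

definition cpar :: "'n::finite set \<Rightarrow> real^'n \<Rightarrow> nat \<Rightarrow> real" where
  "cpar S x = emb (wrap S x)"

text \<open>\<open>Arg2pi\<close> jumps on the positive real axis. Rotating by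
  \<open>- shift S i\<close> before and adding \<open>shift S i\<close> after moves the jump to the
  negative axis when \<open>i\<close> is in \<open>S\<close>. The radial coordinate is r - 1 or 2 -
  r.\<close>

definition ccoord :: "'n::finite set \<Rightarrow> (nat \<Rightarrow> real) \<Rightarrow> real^'n" where
  "ccoord S p = (\<chi> i. if i = nix then eps S * (Re (cpt p (nix :: 'n)) - base S)
     else shift S i + Arg2pi (cpt p i * cis (- shift S i)))"

text \<open>The strict bound 1 excludes the opposite end, so that in every chart the boundary is
  exactly where the distinguished coordinate vanishes.\<close>

definition cbx :: "'n::finite set \<Rightarrow> (real^'n) set" where
  "cbx S = {x. 0 \<le> x $ nix \<and> x $ nix < 1 \<and>
     (\<forall>i. i \<noteq> nix \<longrightarrow> shift S i < x $ i \<and> x $ i < shift S i + 2 * pi)}"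

definition slab_chart :: "'n::finite set \<Rightarrow> (nat \<Rightarrow> real, 'n) chart" where
  "slab_chart S = (cpar S ` cbx S, ccoord S)"

definition slab_atlas :: "(nat \<Rightarrow> real, 'n::finite) chart set" where
  "slab_atlas = range slab_chart"

section \<open>Charts as homeomorphisms, and their covering of the manifold\<close>

lemma eps_sq: "eps S * eps S = 1" "eps S * (eps S * t) = t"
  by (simp_all add: eps_def)

lemma Arg2pi_cis: "0 \<le> t \<Longrightarrow> t < 2 * pi \<Longrightarrow> Arg2pi (cis t) = t"
  by (rule Arg2pi_unique[of 1]) (simp_all add: cis_conv_exp)

lemma cis_Arg2pi: "cmod z = 1 \<Longrightarrow> cis (Arg2pi z) = z"
  using Arg2pi_eq[of z] by (simp add: cis_conv_exp)

lemma Arg2pi_pos_iff: "0 < Arg2pi z \<longleftrightarrow> z \<notin> \<real>\<^sub>\<ge>\<^sub>0"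
  using Arg2pi_eq_0[of z] Arg2pi_ge_0[of z]
  by (auto simp: complex_nonneg_Reals_iff complex_is_Real_iff order.strict_iff_order)

lemma cpt_cpar [simp]: "cpt (cpar S x) = wrap S x"
  by (auto simp: cpar_def)

lemma ccoord_cpar:
  assumes "x \<in> cbx S"
  shows "ccoord S (cpar S x) = x"
proof -
  have "shift S i + Arg2pi (cis (x $ i) * cis (- shift S i)) = x $ i" if "i \<noteq> nix" for i
  proof -
    have "Arg2pi (cis (x $ i - shift S i)) = x $ i - shift S i"
      using assms that by (intro Arg2pi_cis) (auto simp: cbx_def less_imp_le algebra_simps)
    then show ?thesis by (simp add: cis_mult)
  qed
  then show ?thesis by (simp add: ccoord_def wrap_def vec_eq_iff eps_sq)
qed

lemma wrap_in_slab:
  assumes "0 \<le> x $ nix" "x $ nix \<le> 1"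
  shows "wrap S x \<in> slab"
  using assms by (auto simp: slab_def wrap_def base_def eps_def)

text \<open>An open subset of the ambient sequence space that cuts the chart domain out of the
  manifold: it avoids the opposite end and the jumps of the angles.\<close>

definition chart_region :: "'n::finite set \<Rightarrow> (nat \<Rightarrow> real) set" where
  "chart_region S = {p. eps S * (Re (cpt p (nix :: 'n)) - base S) < 1 \<and>
     (\<forall>i::'n. i \<noteq> nix \<longrightarrow> cpt p i * cis (- shift S i) \<notin> \<real>\<^sub>\<ge>\<^sub>0)}"

lemma cpar_in_chart_region:
  assumes "x \<in> cbx S"
  shows "cpar S x \<in> chart_region S"
proof -
  have "cis (x $ i) * cis (- shift S i) \<notin> \<real>\<^sub>\<ge>\<^sub>0" if "i \<noteq> nix" for i
  proof -
    have "Arg2pi (cis (x $ i - shift S i)) = x $ i - shift S i"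
      using assms that by (intro Arg2pi_cis) (auto simp: cbx_def less_imp_le algebra_simps)
    then have "0 < Arg2pi (cis (x $ i) * cis (- shift S i))"
      using assms that by (simp add: cis_mult cbx_def)
    then show ?thesis by (simp add: Arg2pi_pos_iff)
  qed
  then show ?thesis
    using assms by (auto simp: chart_region_def wrap_def eps_sq cbx_def)
qed

lemma ccoord_inverse:
  fixes S :: "'n::finite set"
  assumes "p \<in> slab_points TYPE('n)" "p \<in> chart_region S"
  shows "ccoord S p \<in> cbx S" "cpar S (ccoord S p) = p"
proof -
  obtain z where z: "p = emb z" "z \<in> (slab :: ('n \<Rightarrow> complex) set)"
    using assms(1) by (auto simp: slab_points_def)
  have pos: "0 < Arg2pi (z i * cis (- shift S i))" if "i \<noteq> nix" for i
    using assms(2) that by (auto simp: chart_region_def z(1) Arg2pi_pos_iff)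
  show "ccoord S p \<in> cbx S"
    using assms(2) z pos Arg2pi_lt_2pi
    by (auto simp: cbx_def ccoord_def chart_region_def slab_def eps_def base_def)
  have "cis (shift S i + Arg2pi (z i * cis (- shift S i))) = z i" if "i \<noteq> nix" for i
  proof -
    have "cmod (z i * cis (- shift S i)) = 1" using z(2) that by (simp add: slab_def norm_mult)
    then have "cis (shift S i + Arg2pi (z i * cis (- shift S i))) = cis (shift S i) * (z i * cis (- shift S i))"
      by (simp add: cis_Arg2pi flip: cis_mult)
    also have "\<dots> = z i * (cis (shift S i) * cis (- shift S i))" by (simp only: mult_ac)
    finally show ?thesis by (simp add: cis_mult)
  qed
  moreover have "of_real (base S + eps S * (eps S * (Re (z nix) - base S))) = z nix"
    using z(2) by (simp add: eps_sq slab_def complex_eq_iff)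
  ultimately have "wrap S (ccoord S p) = z"
    by (auto simp: wrap_def ccoord_def z(1) fun_eq_iff)
  then show "cpar S (ccoord S p) = p" by (simp add: cpar_def z(1))
qed

lemma chart_domain:
  fixes S :: "'n::finite set"
  shows "cpar S ` cbx S = slab_points TYPE('n) \<inter> chart_region S"
proof
  show "cpar S ` cbx S \<subseteq> slab_points TYPE('n) \<inter> chart_region S"
    using cpar_in_chart_region by (auto simp: slab_points_def cpar_def cbx_def intro!: imageI wrap_in_slab)
  show "slab_points TYPE('n) \<inter> chart_region S \<subseteq> cpar S ` cbx S"
    using ccoord_inverse by (metis IntE image_eqI subsetI)
qed

lemma open_chart_region: "open (chart_region (S :: 'n::finite set))"
proof -
  have "chart_region S = {p. eps S * (Re (cpt p (nix :: 'n)) - base S) < 1} \<inter>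
     (\<Inter>i\<in>- {nix}. (\<lambda>p. cpt p i * cis (- shift S i)) -` (- \<real>\<^sub>\<ge>\<^sub>0))"
    by (auto simp: chart_region_def)
  also have "open \<dots>"
    by (intro open_Int open_INT ballI open_vimage open_Collect_less continuous_intros continuous_cpt) auto
  finally show ?thesis .
qed

lemma continuous_cpar: "continuous_on A (cpar S)"
  unfolding cpar_def
proof (rule continuous_emb)
  fix i show "continuous_on A (\<lambda>x. wrap S x i)"
    by (cases "i = nix") (auto simp: wrap_def cis_conv_exp intro!: continuous_intros)
qed

lemma continuous_ccoord: "continuous_on (chart_region S) (ccoord S)"
proof -
  have arg: "continuous_on (chart_region S) (\<lambda>p. Arg2pi (cpt p i * cis (- shift S i)))" if "i \<noteq> nix" for i
  proof (rule continuous_on_compose2[where g = Arg2pi and t = "- \<real>\<^sub>\<ge>\<^sub>0"])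
    show "continuous_on (- \<real>\<^sub>\<ge>\<^sub>0) Arg2pi"
      by (intro continuous_at_imp_continuous_on ballI continuous_at_Arg2pi) auto
  qed (use that in \<open>auto simp: chart_region_def intro!: continuous_intros continuous_cpt\<close>)
  show ?thesis
    unfolding ccoord_def
  proof (intro continuous_on_vec_lambda)
    fix i
    show "continuous_on (chart_region S) (\<lambda>p. if i = nix then eps S * (Re (cpt p (nix :: 'a)) - base S)
        else shift S i + Arg2pi (cpt p i * cis (- shift S i)))"
      by (cases "i = nix") (auto intro!: continuous_intros continuous_cpt arg)
  qed
qed

lemma cdom_slab_chart: "cdom (slab_chart S :: (_, 'n::finite) chart) = slab_points TYPE('n) \<inter> chart_region S"
  by (simp add: slab_chart_def chart_domain)

lemma coord_slab_chart [simp]: "coord (slab_chart S) = ccoord S"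
  by (simp add: slab_chart_def)

lemma cimg_slab_chart: "cimg (slab_chart S) = cbx S"
  by (auto simp: cimg_def slab_chart_def ccoord_cpar image_iff)

lemma param_slab_chart: "x \<in> cbx S \<Longrightarrow> param (slab_chart S) x = cpar S x"
  unfolding param_def slab_chart_def fst_conv snd_conv
  by (rule inv_into_f_eq) (auto simp: inj_on_def ccoord_cpar)

lemma openin_cbx: "openin (top_of_set half_space) (cbx S)"
proof -
  have "cbx S = half_space \<inter> ({x. x $ nix < 1} \<inter>
     (\<Inter>i\<in>- {nix}. {x. shift S i < x $ i} \<inter> {x. x $ i < shift S i + 2 * pi}))"
    by (auto simp: cbx_def half_space_def)
  also have "openin (top_of_set half_space) \<dots>"
    by (intro openin_open_Int open_Int open_INT ballI open_Collect_less continuous_intros) auto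
  finally show ?thesis .
qed

lemma is_chart_slab:
  fixes S :: "'n::finite set"
  shows "is_chart (slab_top TYPE('n)) (slab_chart S)"
proof -
  have "homeomorphic_maps (top_of_set (slab_points TYPE('n) \<inter> chart_region S)) (top_of_set (cbx S))
      (ccoord S) (cpar S)"
    unfolding homeomorphic_maps_def continuous_map_in_subtopology
    using ccoord_inverse[of _ S] ccoord_cpar[of _ S] chart_domain[of S]
      continuous_on_subset[OF continuous_ccoord, of "slab_points TYPE('n) \<inter> chart_region S" S]
    by (auto simp: continuous_map_iff_continuous2 continuous_cpar image_subset_iff)
  then have "homeomorphic_map (top_of_set (slab_points TYPE('n) \<inter> chart_region S)) (top_of_set (cbx S)) (ccoord S)"
    by (auto simp: homeomorphic_map_maps)
  then show ?thesis
    by (auto simp: is_chart_def cdom_slab_chart cimg_slab_chart openin_cbx slab_top_def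
        subtopology_subtopology Int_absorb1 open_chart_region openin_open_Int
        simp flip: Int_assoc)
qed

lemma slab_points_covered:
  fixes p :: "nat \<Rightarrow> real"
  assumes "p \<in> slab_points TYPE('n::finite)"
  shows "\<exists>S :: 'n set. p \<in> chart_region S"
proof -
  obtain z where z: "p = emb z" "z \<in> (slab :: ('n \<Rightarrow> complex) set)"
    using assms by (auto simp: slab_points_def)
  \<comment> \<open>The end 1 serves unless r = 2. A number of modulus 1 on the positive axis is 1
    and is turned to - 1 by the rotation through pi; all others already avoid the jump.\<close>
  define S where "S = {i. if i = nix then Re (z nix) < 2 else z i \<in> \<real>\<^sub>\<ge>\<^sub>0}"
  have "z i * cis (- shift S i) \<notin> \<real>\<^sub>\<ge>\<^sub>0" if i: "i \<noteq> nix" for i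
  proof (cases "z i \<in> \<real>\<^sub>\<ge>\<^sub>0")
    case False
    then show ?thesis using i by (simp add: shift_def S_def)
  next
    case True
    then have "Re (z i) > 0"
      using z(2) i by (auto simp: slab_def complex_nonneg_Reals_iff cmod_def order.strict_iff_order)
    then show ?thesis using True i by (auto simp: shift_def S_def complex_nonneg_Reals_iff)
  qed
  moreover have "eps S * (Re (z nix) - base S) < 1"
    using z(2) by (auto simp: S_def eps_def base_def slab_def)
  ultimately have "p \<in> chart_region S" by (simp add: chart_region_def z(1))
  then show ?thesis ..
qed

lemma boundary_slab:
  "boundary (slab_atlas :: (_, 'n::finite) chart set) =
     {p \<in> slab_points TYPE('n). Re (cpt p (nix :: 'n)) \<in> {1, 2}}"
proof (intro equalityI subsetI)
  fix p assume "p \<in> boundary (slab_atlas :: (_, 'n) chart set)"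
  then show "p \<in> {p \<in> slab_points TYPE('n). Re (cpt p (nix :: 'n)) \<in> {1, 2}}"
    by (auto simp: boundary_def slab_atlas_def cdom_slab_chart ccoord_def eps_def base_def split: if_splits)
next
  fix p assume p: "p \<in> {p \<in> slab_points TYPE('n). Re (cpt p (nix :: 'n)) \<in> {1, 2}}"
  then obtain S :: "'n set" where S: "p \<in> chart_region S" using slab_points_covered by blast
  then have "ccoord S p $ nix = 0"
    using p by (auto simp: ccoord_def chart_region_def eps_def base_def split: if_splits)
  with S p show "p \<in> boundary (slab_atlas :: (_, 'n) chart set)"
    by (auto simp: boundary_def slab_atlas_def cdom_slab_chart)
qed

lemma cpt_nix_ccoord: "Re (cpt p (nix :: 'n::finite)) = base S + eps S * ccoord S p $ (nix :: 'n)"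
  by (simp add: ccoord_def eps_sq)


section \<open>Transition maps\<close>

definition overlap :: "'n::finite set \<Rightarrow> 'n set \<Rightarrow> (real^'n) set" where
  "overlap S S' = cbx S \<inter> cpar S -` chart_region S'"

lemma overlap_eq:
  "coord (slab_chart S) ` (cdom (slab_chart S) \<inter> cdom (slab_chart S')) = overlap S (S' :: 'n::finite set)"
proof -
  have "coord (slab_chart S) ` (cdom (slab_chart S) \<inter> cdom (slab_chart S')) =
      ccoord S ` ((cpar S ` cbx S) \<inter> chart_region S')"
    by (auto simp: cdom_slab_chart chart_domain)
  also have "\<dots> = overlap S S'"
  proof
    show "ccoord S ` (cpar S ` cbx S \<inter> chart_region S') \<subseteq> overlap S S'"
      by (auto simp: overlap_def ccoord_cpar)
    show "overlap S S' \<subseteq> ccoord S ` (cpar S ` cbx S \<inter> chart_region S')"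
    proof
      fix x assume "x \<in> overlap S S'"
      then show "x \<in> ccoord S ` (cpar S ` cbx S \<inter> chart_region S')"
        by (intro image_eqI[of _ _ "cpar S x"]) (auto simp: overlap_def ccoord_cpar)
    qed
  qed
  finally show ?thesis .
qed

lemma openin_overlap: "openin (top_of_set half_space) (overlap S S')"
proof -
  have "overlap S S' = cbx S \<inter> (cpar S -` chart_region S')" by (auto simp: overlap_def)
  moreover have "open (cpar S -` chart_region S')"
    by (rule open_vimage[OF open_chart_region continuous_cpar])
  ultimately show ?thesis using openin_cbx[of S] openin_Int_open by metis
qed

lemma transition_nix:
  fixes S S' :: "'n::finite set"
  shows "ccoord S' (cpar S x) $ nix = eps S' * (base S - base S') + eps S * eps S' * x $ nix"
  by (simp add: ccoord_def wrap_def algebra_simps)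

text \<open>An angle and its \<open>Arg2pi\<close> normalization have the same \<open>cis\<close>,
  hence differ by a multiple of 2 pi.\<close>

lemma transition_other:
  fixes S S' :: "'n::finite set"
  assumes "i \<noteq> nix"
  shows "\<exists>k::int. ccoord S' (cpar S x) $ i = x $ i + 2 * pi * k"
proof -
  define a where "a = x $ i - shift S' i"
  have "cis a = cis (Arg2pi (cis a))" by (simp add: cis_Arg2pi)
  then have "sin a = sin (Arg2pi (cis a)) \<and> cos a = cos (Arg2pi (cis a))"
    by (metis cis.sel)
  then obtain k :: int where k: "a = Arg2pi (cis a) + 2 * pi * k"
    unfolding sin_cos_eq_iff ..
  have "ccoord S' (cpar S x) $ i = shift S' i + Arg2pi (cis a)"
    using assms by (simp add: ccoord_def wrap_def cis_mult a_def)
  then show ?thesis using k by (intro exI[of _ "- k"]) (simp add: a_def)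
qed

definition flip :: "'n::finite set \<Rightarrow> 'n set \<Rightarrow> real^'n \<Rightarrow> real^'n" where
  "flip S S' v = diagm (eps S * eps S') 1 *v v"

text \<open>The multiple of 2 pi is an integer depending continuously on the point, hence locally
  constant. The overlap can be disconnected, with different constants on its components, so the
  translation \<open>c\<close> is only local.\<close>

lemma transition_locally_affine:
  fixes S S' :: "'n::finite set"
  assumes x: "x \<in> overlap S S'"
  shows "\<exists>U c. open U \<and> x \<in> U \<and>
    (\<forall>y\<in>U \<inter> overlap S S'. ccoord S' (cpar S y) = flip S S' y + c)"
proof -
  let ?\<tau> = "\<lambda>y. ccoord S' (cpar S y)"
  have cont: "continuous_on (overlap S S') ?\<tau>"
    by (rule continuous_on_compose2[OF continuous_ccoord continuous_cpar]) (auto simp: overlap_def)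
  obtain V where V: "open V" "x \<in> V" "\<And>y. y \<in> V \<Longrightarrow> y \<in> overlap S S' \<Longrightarrow> dist (?\<tau> y) (?\<tau> x) < 1"
  proof -
    obtain d where "d > 0" "\<And>y. y \<in> overlap S S' \<Longrightarrow> dist y x < d \<Longrightarrow> dist (?\<tau> y) (?\<tau> x) < 1"
      using cont x unfolding continuous_on_iff by (meson zero_less_one)
    then show ?thesis using that[of "ball x d"] by (simp add: dist_commute)
  qed
  define U where "U = V \<inter> ball x 1"
  have "?\<tau> y = flip S S' y + (?\<tau> x - flip S S' x)" if y: "y \<in> U \<inter> overlap S S'" for y
  proof (rule vec_eq_iff[THEN iffD2], rule allI)
    fix i
    show "?\<tau> y $ i = (flip S S' y + (?\<tau> x - flip S S' x)) $ i"
    proof (cases "i = nix")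
      case True
      then show ?thesis by (simp add: transition_nix flip_def diagm_mult_vec)
    next
      case False
      obtain k l :: int where kl: "?\<tau> y $ i = y $ i + 2 * pi * k" "?\<tau> x $ i = x $ i + 2 * pi * l"
        using transition_other[OF False] by metis
      have "\<bar>?\<tau> y $ i - ?\<tau> x $ i\<bar> < 1" "\<bar>y $ i - x $ i\<bar> < 1"
        using V(3)[of y] y component_le_norm_cart[of "?\<tau> y - ?\<tau> x" i] component_le_norm_cart[of "y - x" i]
        by (auto simp: U_def dist_norm norm_minus_commute)
      \<comment> \<open>The two bounds by 1 add up to 2, while a nonzero k - l would give at least 2
        pi.\<close>
      then have "\<bar>2 * pi * (k - l)\<bar> < 2" by (simp add: kl algebra_simps)
      then have "2 * pi * \<bar>real_of_int (k - l)\<bar> < 2" by (simp add: abs_mult)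
      moreover have "2 * pi * \<bar>real_of_int (k - l)\<bar> \<ge> 2 * \<bar>real_of_int (k - l)\<bar>"
        using pi_gt3 by (intro mult_right_mono) auto
      ultimately have "2 * \<bar>real_of_int (k - l)\<bar> < 2" by (rule order_le_less_trans[rotated])
      then have "\<bar>real_of_int (k - l)\<bar> < 1" by (simp del: of_int_diff)
      then have "k = l" by linarith
      then show ?thesis using False by (simp add: kl flip_def diagm_mult_vec)
    qed
  qed
  then show ?thesis using V by (intro exI[of _ U] exI[of _ "?\<tau> x - flip S S' x"]) (auto simp: U_def)
qed

lemma bounded_linear_flip: "bounded_linear (flip S S')"
  unfolding flip_def[abs_def] by (rule matrix_vector_mul_bounded_linear)

lemma smooth_transition:
  fixes S S' :: "'n::finite set"
  shows "smooth_on (coord (slab_chart S') \<circ> param (slab_chart S)) (overlap S S')"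
  unfolding smooth_on_def
proof
  fix x assume x: "x \<in> overlap S S'"
  obtain U c where U: "open U" "x \<in> U" "\<forall>y\<in>U \<inter> overlap S S'. ccoord S' (cpar S y) = flip S S' y + c"
    using transition_locally_affine[OF x] by (elim exE conjE)
  show "\<exists>U F. open U \<and> x \<in> U \<and> (\<forall>k. Ck_on k F U) \<and>
      (\<forall>y\<in>U \<inter> overlap S S'. F y = (coord (slab_chart S') \<circ> param (slab_chart S)) y)"
  proof (intro exI conjI)
    show "\<forall>k. Ck_on k (\<lambda>y. flip S S' y + c) U"
      by (intro allI Ck_on_affine[OF U(1) bounded_linear_flip])
    show "\<forall>y\<in>U \<inter> overlap S S'. flip S S' y + c = (coord (slab_chart S') \<circ> param (slab_chart S)) y"
      using U(3) by (simp add: overlap_def param_slab_chart)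
  qed (rule U)+
qed

lemma jacobian_slab:
  fixes S S' :: "'n::finite set"
  assumes p: "p \<in> cdom (slab_chart S) \<inter> cdom (slab_chart S')"
  shows "jacobian (slab_chart S) (slab_chart S') p = diagm (eps S * eps S') 1"
proof -
  define x where "x = ccoord S p"
  have x: "x \<in> overlap S S'" using p overlap_eq[of S S'] by (auto simp: x_def)
  obtain U c where U: "open U" "x \<in> U" "\<forall>y\<in>U \<inter> overlap S S'. ccoord S' (cpar S y) = flip S S' y + c"
    using transition_locally_affine[OF x] by (elim exE conjE)
  have aff: "((\<lambda>y. flip S S' y + c) has_derivative flip S S') (at x within overlap S S')"
    using has_derivative_add[OF bounded_linear_imp_has_derivative[OF bounded_linear_flip] has_derivative_const]
    by simp
  obtain d where d: "d > 0" "ball x d \<subseteq> U" using U(1,2) openE by blast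
  have eq: "flip S S' y + c = (coord (slab_chart S') \<circ> param (slab_chart S)) y"
    if "y \<in> overlap S S'" "dist y x < d" for y
  proof -
    have "y \<in> U \<inter> overlap S S'" using d(2) that by (auto simp: dist_commute)
    then show ?thesis using U(3) by (simp add: overlap_def param_slab_chart)
  qed
  have "((coord (slab_chart S') \<circ> param (slab_chart S)) has_derivative flip S S')
      (at x within overlap S S')"
    by (rule has_derivative_transform_within[OF aff d(1) x eq])
  from frechet_derivative_half_space[OF openin_overlap x this]
  show ?thesis
    unfolding jacobian_def overlap_eq unfolding coord_slab_chart x_def[symmetric]
    by (simp add: flip_def[abs_def])
qed


section \<open>Global structure\<close>

lemma manifold_slab: "manifold_with_boundary (slab_top TYPE('n::finite)) (slab_atlas :: (_, 'n) chart set)"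
proof -
  have sc: "second_countable (slab_top TYPE('n))"
    unfolding slab_top_def
  proof (rule second_countable_subtopology)
    obtain B :: "(nat \<Rightarrow> real) set set" where B: "countable B" "topological_basis B"
      using ex_countable_basis by blast
    have "\<exists>V\<in>B. x \<in> V \<and> V \<subseteq> U" if "open U" "x \<in> U" for U x
      using topological_basisE[OF B(2) that] by metis
    then show "second_countable (euclidean :: (nat \<Rightarrow> real) topology)"
      unfolding second_countable_def using B(1) topological_basis_open[OF B(2)]
      by (intro exI[of _ B] conjI ballI allI impI) simp_all
  qed
  have cov: "(\<Union>c\<in>(slab_atlas :: (_, 'n) chart set). cdom c) = topspace (slab_top TYPE('n))"
    using slab_points_covered by (auto simp: slab_atlas_def cdom_slab_chart slab_top_def)
  have sm: "smooth_on (coord c' \<circ> param c) (coord c ` (cdom c \<inter> cdom c'))"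
    if cc': "c \<in> slab_atlas" "c' \<in> slab_atlas" for c c' :: "(_, 'n) chart"
  proof -
    obtain S S' where "c = slab_chart S" "c' = slab_chart S'"
      using cc' by (auto simp: slab_atlas_def)
    then show ?thesis using smooth_transition[of S' S] by (simp only: overlap_eq)
  qed
  have hd: "Hausdorff_space (slab_top TYPE('n))"
    unfolding slab_top_def by (intro Hausdorff_space_subtopology Hausdorff_space_euclidean)
  have ic: "\<forall>c\<in>(slab_atlas :: (_, 'n) chart set). is_chart (slab_top TYPE('n)) c"
    by (simp add: slab_atlas_def is_chart_slab)
  show ?thesis
    unfolding manifold_with_boundary_def by (intro conjI sc cov sm hd ic ballI)
qed

text \<open>The parametrization of one chart, continued to the closed box, is onto though no longer
  injective. Compactness and connectedness are inherited from the box.\<close>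

lemma slab_points_image:
  "slab_points TYPE('n::finite) =
     cpar {nix} ` {x :: real^'n. \<forall>i. 0 \<le> x $ i \<and> x $ i \<le> (if i = nix then 1 else 2 * pi)}"
  (is "_ = _ ` ?B")
proof (intro equalityI subsetI)
  fix p assume "p \<in> slab_points TYPE('n)"
  then obtain z where z: "p = emb z" "z \<in> (slab :: ('n \<Rightarrow> complex) set)"
    by (auto simp: slab_points_def)
  define x :: "real^'n" where "x = (\<chi> i. if i = nix then Re (z nix) - 1 else Arg2pi (z i))"
  have "wrap {nix} x = z"
    using z(2) by (auto simp: wrap_def x_def fun_eq_iff slab_def cis_Arg2pi base_def eps_def complex_eq_iff)
  moreover have "x \<in> ?B" using z(2) Arg2pi_lt_2pi Arg2pi_ge_0 by (auto simp: x_def slab_def less_imp_le)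
  ultimately show "p \<in> cpar {nix} ` ?B" by (intro image_eqI[of _ _ x]) (simp_all add: cpar_def z(1))
next
  fix p assume "p \<in> cpar {nix} ` ?B"
  then obtain x where x: "p = cpar {nix} x" "x \<in> ?B" by blast
  have "0 \<le> x $ i \<and> x $ i \<le> (if i = nix then 1 else 2 * pi)" for i using x(2) by blast
  from this[of nix] have "0 \<le> x $ nix" "x $ nix \<le> 1" by auto
  then show "p \<in> slab_points TYPE('n)" using x wrap_in_slab by (auto simp: slab_points_def cpar_def)
qed

lemma slab_points_compact_connected:
  "compact (slab_points TYPE('n::finite))" "connected (slab_points TYPE('n))"
proof -
  have "{x :: real^'n. \<forall>i. 0 \<le> x $ i \<and> x $ i \<le> (if i = nix then 1 else 2 * pi)} =
      cbox 0 (\<chi> i. if i = nix then 1 else 2 * pi)"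
    by (simp add: set_eq_iff mem_box_cart)
  then have e: "slab_points TYPE('n) = cpar {nix} ` cbox 0 (\<chi> i :: 'n. if i = nix then 1 else 2 * pi)"
    by (simp add: slab_points_image)
  show "compact (slab_points TYPE('n))"
    unfolding e by (intro compact_continuous_image continuous_cpar compact_cbox)
  show "connected (slab_points TYPE('n))"
    unfolding e by (intro connected_continuous_image continuous_cpar convex_connected convex_box)
qed

lemma slab_compact: "compact_space (slab_top TYPE('n::finite))"
  unfolding slab_top_def
  using slab_points_compact_connected(1)[where 'n = 'n] by (simp add: compact_space_subtopology compactin_euclidean_iff)

lemma slab_connected: "connected_space (slab_top TYPE('n::finite))"
  unfolding slab_top_def
  using slab_points_compact_connected(2)[where 'n = 'n] by (simp add: connectedin_def flip: connectedin_iff_connected)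

lemma boundary_slab_nonempty: "boundary (slab_atlas :: (_, 'n::finite) chart set) \<noteq> {}"
proof -
  have "wrap {nix} (0 :: real^'n) \<in> slab" by (rule wrap_in_slab) auto
  then have "cpar {nix} (0 :: real^'n) \<in> boundary (slab_atlas :: (_, 'n) chart set)"
    by (simp add: boundary_slab slab_points_def cpar_def wrap_def base_def)
  then show ?thesis by blast
qed


section \<open>Spin structure\<close>

lemma cl_mult_one_right: "cl_mult x cl_one = x"
proof -
  have "(\<Sum>S\<in>UNIV. \<Sum>T\<in>UNIV. if sym_diff S T = R then cl_sign S T * (x $ S) * (cl_one $ T) else 0) = x $ R" for R
  proof -
    have "(\<Sum>T\<in>UNIV. if sym_diff S T = R then cl_sign S T * (x $ S) * (cl_one $ T) else 0) =
        (if S = R then x $ S else 0)" for S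
      by (subst sum_single[of "{}"]) (auto simp: cl_one_def axis_def cl_sign_def)
    then show ?thesis by (simp add: sum_single[of R])
  qed
  then show ?thesis by (simp add: cl_mult_def vec_eq_iff)
qed

lemma cl_mult_one_left: "cl_mult cl_one x = x"
proof -
  have "(\<Sum>S\<in>UNIV. \<Sum>T\<in>UNIV. if sym_diff S T = R then cl_sign S T * (cl_one $ S) * (x $ T) else 0) = x $ R" for R
  proof -
    have "(\<Sum>T\<in>UNIV. if sym_diff S T = R then cl_sign S T * (cl_one $ S) * (x $ T) else 0) =
        (if S = {} then x $ R else 0)" for S
    proof (cases "S = {}")
      case True
      then show ?thesis by (subst sum_single[of R]) (auto simp: cl_one_def axis_def cl_sign_def)
    next
      case False
      then have "cl_one $ S = 0" by (simp add: cl_one_def axis_def)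
      then show ?thesis using False by (simp only: mult_zero_left mult_zero_right if_cancel sum.neutral_const if_False)
    qed
    then show ?thesis by (simp add: sum_single[of "{}"])
  qed
  then show ?thesis by (simp add: cl_mult_def vec_eq_iff)
qed

lemma cl_vec_nth: "cl_vec v $ {i} = v $ i"
  unfolding cl_vec_def sum_component by (subst sum_single[of i]) (auto simp: axis_def)

text \<open>The definite description is settled by the injectivity of \<open>cl_vec\<close>.\<close>

lemma spin_cover_one: "spin_cover cl_one = (mat 1 :: real^'n^'n::finite)"
  unfolding spin_cover_def cl_mult_one_left cl_mult_one_right
proof (rule the_equality)
  fix M :: "real^'n^'n"
  assume M: "\<forall>v. cl_vec v = cl_vec (M *v v)"
  have "M *v v = mat 1 *v v" for v
    using M by (metis cl_vec_nth matrix_vector_mul_lid vec_eq_iff)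
  then show "M = mat 1" by (simp add: matrix_eq)
qed simp

text \<open>The components of the global frame are functions of the chart rather than of its index, so
  the orientation of the chart has to be read off from its domain.\<close>

definition side_sign :: "(nat \<Rightarrow> real, 'n::finite) chart \<Rightarrow> real" where
  "side_sign c = (if \<exists>p\<in>cdom c. Re (cpt p (nix :: 'n)) = 1 then 1 else - 1)"

lemma side_sign_slab: "side_sign (slab_chart S :: (_, 'n::finite) chart) = eps S"
proof (cases "nix \<in> S")
  case True
  \<comment> \<open>A point of the chart at the end r = 1, with all angles in the middle of their
    intervals.\<close>
  define x :: "real^'n" where "x = (\<chi> i. if i = nix then 0 else shift S i + pi)"
  have "x \<in> cbx S" by (simp add: cbx_def x_def)
  then have "cpar S x \<in> cdom (slab_chart S)" by (simp add: slab_chart_def)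
  moreover have "Re (cpt (cpar S x) (nix :: 'n)) = 1" using True by (simp add: wrap_def x_def base_def)
  ultimately have "\<exists>p\<in>cdom (slab_chart S). Re (cpt p (nix :: 'n)) = 1" by blast
  then show ?thesis using True by (simp add: side_sign_def eps_def)
next
  case False
  then show ?thesis by (auto simp: side_sign_def eps_def cdom_slab_chart chart_region_def base_def)
qed

text \<open>Jacobians are diag(1, ..., 1) or diag(- 1, 1, ..., 1), and the sign occurs squared. Any
  choice of \<open>a\<close> and \<open>b\<close> at each point, used alike in all charts, thus
  obeys the transformation law.\<close>

lemma invariant_diagm_metric:
  assumes "c \<in> (slab_atlas :: (_, 'n::finite) chart set)" "c' \<in> slab_atlas" "p \<in> cdom c \<inter> cdom c'"
  shows "diagm a b = transpose (jacobian c c' p) ** diagm a b ** jacobian c c' p"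
proof -
  obtain S S' where SS': "c = slab_chart S" "c' = slab_chart S'"
    using assms(1,2) by (auto simp: slab_atlas_def)
  have "eps S * eps S' * a * (eps S * eps S') = a" "1 * b * 1 = b" by (auto simp: eps_def)
  then show ?thesis
    using assms(3) by (simp only: SS' jacobian_slab transpose_diagm diagm_mult)
qed

text \<open>The manifold is parallelizable: the coordinate frame, with its radial vector reversed in
  the charts at the end 2, is global and orthonormal for the flat product metric. Using it over
  every member of the cover makes all transition functions trivial, with constant lift
  \<open>cl_one\<close>.\<close>

lemma spin_manifold_slab: "spin_manifold (slab_top TYPE('n::finite)) (slab_atlas :: (_, 'n) chart set)"
proof -
  let ?T = "slab_top TYPE('n)" and ?A = "slab_atlas :: (_, 'n) chart set"
  let ?h = "\<lambda>(c :: (_, 'n) chart) (p :: nat \<Rightarrow> real). mat 1 :: real^'n^'n"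
  let ?e = "\<lambda>(i :: nat) (c :: (_, 'n) chart) (p :: nat \<Rightarrow> real). diagm (side_sign c) 1 :: real^'n^'n"
  let ?s = "\<lambda>(i :: nat) (j :: nat) (p :: nat \<Rightarrow> real). cl_one :: 'n clifford"
  have sq: "side_sign c * side_sign c = 1" for c :: "(_, 'n) chart" by (simp add: side_sign_def)
  have frame: "?e i c' p = jacobian c c' p ** ?e i c p"
    if c: "c \<in> ?A" "c' \<in> ?A" "p \<in> cdom c \<inter> cdom c'" for i c c' p
  proof -
    obtain S S' where SS': "c = slab_chart S" "c' = slab_chart S'"
      using c(1,2) by (auto simp: slab_atlas_def)
    have "eps S * eps S' * eps S = eps S'" by (auto simp: eps_def)
    then show ?thesis
      using c(3) by (simp only: SS' side_sign_slab jacobian_slab diagm_mult mult_1_left)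
  qed
  have "riemannian_metric ?A ?h"
    unfolding riemannian_metric_def
  proof (intro conjI ballI allI impI)
    fix c assume "c \<in> ?A"
    show "smooth_on (\<lambda>x. ?h c (param c x)) (cimg c)"
      unfolding smooth_on_def
      by (intro ballI exI[of _ UNIV] exI[of _ "\<lambda>_. mat 1"]) (simp add: Ck_on_const)
  next
    fix c c' p assume "c \<in> ?A" "c' \<in> ?A" "p \<in> cdom c \<inter> cdom c'"
    then show "?h c p = transpose (jacobian c c' p) ** ?h c' p ** jacobian c c' p"
      using invariant_diagm_metric[of c c' p 1 1] by (simp only: diagm_one)
  qed (simp_all add: transpose_mat)
  moreover have "spin_structure ?T ?A ?h (\<lambda>_. topspace ?T) ?e ?s"
    unfolding spin_structure_def
    using frame
    by (simp add: transpose_diagm diagm_mult sq diagm_one spin_cover_one cl_mult_one_left spin_group.one)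
  ultimately show ?thesis
    using manifold_slab unfolding spin_manifold_def by blast
qed


section \<open>The toroidal Schwarzschild--de Sitter metrics\<close>

text \<open>The function F of the overview, where \<open>N\<close> stands for n - 2.\<close>

definition warp :: "real \<Rightarrow> real \<Rightarrow> nat \<Rightarrow> real \<Rightarrow> real" where
  "warp m k N r = m / r ^ N - k * r\<^sup>2"

definition warp_deriv :: "real \<Rightarrow> real \<Rightarrow> nat \<Rightarrow> real \<Rightarrow> real" where
  "warp_deriv m k N r = - (real N * m / r ^ Suc N) - 2 * k * r"

text \<open>The components ignore the chart: every radial coordinate is r up to sign and
  translation, so its component is 1 / F in all charts.\<close>

definition warped_metric :: "real \<Rightarrow> real \<Rightarrow> (nat \<Rightarrow> real, 'n::finite) metric" where
  "warped_metric m k c p =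
     diagm (1 / warp m k (CARD('n) - 2) (Re (cpt p (nix :: 'n)))) ((Re (cpt p (nix :: 'n)))\<^sup>2)"

lemma inverse_power_has_derivative:
  fixes c r :: real
  assumes "r \<noteq> 0"
  shows "((\<lambda>r. c / r ^ N) has_real_derivative - (real N * c / r ^ Suc N)) (at r)"
proof -
  have "((\<lambda>r. c / r ^ N) has_real_derivative
      (0 * r ^ N - c * (real N * r ^ (N - Suc 0))) / (r ^ N * r ^ N)) (at r)"
    using assms by (intro DERIV_divide DERIV_const DERIV_pow) simp
  moreover have "(0 * r ^ N - c * (real N * r ^ (N - Suc 0))) / (r ^ N * r ^ N) = - (real N * c / r ^ Suc N)"
    using assms by (cases N) (simp_all add: field_simps)
  ultimately show ?thesis by simp
qed

lemma warp_has_derivative: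
  assumes "r \<noteq> 0"
  shows "(warp m k N has_real_derivative warp_deriv m k N r) (at r)"
  unfolding warp_def[abs_def] warp_deriv_def
  by (rule derivative_eq_intros inverse_power_has_derivative assms refl | simp)+

lemma warp_deriv_has_derivative:
  assumes "r \<noteq> 0"
  shows "(warp_deriv m k N has_real_derivative
     real (Suc N) * (real N * m) / r ^ Suc (Suc N) - 2 * k) (at r)"
  unfolding warp_deriv_def[abs_def]
  by (rule derivative_eq_intros inverse_power_has_derivative assms refl | simp)+

section \<open>Smoothness and curvature of the metrics\<close>

context
  fixes m k :: real
  assumes card: "CARD('n::finite) \<ge> 3"
    and pos: "\<And>r. 1 \<le> r \<Longrightarrow> r \<le> 2 \<Longrightarrow> warp m k (CARD('n) - 2) r > 0"
begin

abbreviation (input) \<rho> :: "'n set \<Rightarrow> real \<Rightarrow> real" where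
  "\<rho> S t \<equiv> base S + eps S * t"

lemma rho_range:
  fixes S :: "'n set"
  assumes "x \<in> cbx S"
  shows "1 \<le> \<rho> S (x $ nix)" "\<rho> S (x $ nix) \<le> 2"
  using assms by (auto simp: cbx_def base_def eps_def)

lemma warped_metric_cpar:
  fixes S :: "'n set" and c :: "(nat \<Rightarrow> real, 'n) chart"
  assumes "x \<in> cbx S"
  shows "warped_metric m k c (param (slab_chart S) x) =
    diagm (1 / warp m k (CARD('n) - 2) (\<rho> S (x $ nix))) ((\<rho> S (x $ nix))\<^sup>2)"
  using assms by (simp add: warped_metric_def param_slab_chart wrap_def)

text \<open>The radial component 1 / F equals r^N / (m - k r^(N+2)), a rational function singular
  only where its denominator vanishes. It and r^2 are extended holomorphically in the radial
  coordinate, and the higher complex derivatives provide the sequences for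
  \<open>Ck_on_compose_component\<close>. The resulting extension lives on an open set reaching
  beyond the half space.\<close>

lemma smooth_warped_metric:
  fixes S :: "'n set" and c :: "(nat \<Rightarrow> real, 'n) chart"
  shows "smooth_on (\<lambda>x. warped_metric m k c (param (slab_chart S) x) :: real^'n^'n) (cbx S)"
  unfolding smooth_on_def
proof
  fix x assume x: "x \<in> cbx S"
  define N where "N = CARD('n) - 2"
  define f where "f = (\<lambda>w::complex. (of_real (base S) + of_real (eps S) * w) ^ N /
     (of_real m - of_real k * (of_real (base S) + of_real (eps S) * w) ^ (N + 2)))"
  define g where "g = (\<lambda>w::complex. (of_real (base S) + of_real (eps S) * w)\<^sup>2)"
  define W where "W = {w::complex. of_real m - of_real k * (of_real (base S) + of_real (eps S) * w) ^ (N + 2) \<noteq> 0}"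
  have W: "open W" unfolding W_def by (intro open_Collect_neq continuous_intros)
  have hol: "f holomorphic_on W" "g holomorphic_on W"
    unfolding f_def g_def W_def by (auto intro!: holomorphic_intros)
  define U where "U = {y::real^'n. complex_of_real (y $ nix) \<in> W}"
  have "continuous_on UNIV (\<lambda>y::real^'n. complex_of_real (y $ nix))" by (intro continuous_intros)
  from open_vimage[OF W this] have U: "open U" by (simp add: U_def vimage_def)
  define A where "A = (\<lambda>j t. Re ((deriv ^^ j) f (of_real t)))"
  define B where "B = (\<lambda>j t. Re ((deriv ^^ j) g (of_real t)))"
  have A0: "A 0 t = \<rho> S t ^ N / (m - k * \<rho> S t ^ (N + 2))" for t
  proof -
    have "f (of_real t) = of_real (\<rho> S t ^ N / (m - k * \<rho> S t ^ (N + 2)))"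
      by (simp add: f_def)
    then show ?thesis by (simp add: A_def)
  qed
  have B0: "B 0 t = (\<rho> S t)\<^sup>2" for t
  proof -
    have "g (of_real t) = of_real ((\<rho> S t)\<^sup>2)"
      by (simp add: g_def)
    then show ?thesis by (simp add: B_def)
  qed
  have warp_eq: "1 / warp m k N r = r ^ N / (m - k * r ^ (N + 2))" if "r \<noteq> 0" for r
  proof -
    have "warp m k N r = (m - k * r ^ (N + 2)) / r ^ N"
      using that by (simp add: warp_def diff_divide_distrib power_add power2_eq_square)
    then show ?thesis by simp
  qed
  have inU: "y \<in> U" if y: "y \<in> cbx S" for y
  proof -
    have "m - k * \<rho> S (y $ nix) ^ (N + 2) \<noteq> 0"
      using pos[OF rho_range[OF y]] warp_eq[of "\<rho> S (y $ nix)"] rho_range[OF y] by (auto simp: N_def)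
    moreover have "of_real m - of_real k * (of_real (base S) + of_real (eps S) * of_real (y $ nix)) ^ (N + 2) =
      complex_of_real (m - k * \<rho> S (y $ nix) ^ (N + 2))" by simp
    ultimately show ?thesis unfolding U_def W_def mem_Collect_eq by (metis of_real_eq_0_iff)
  qed
  show "\<exists>U F. open U \<and> x \<in> U \<and> (\<forall>k. Ck_on k F U) \<and>
      (\<forall>y\<in>U \<inter> cbx S. F y = (warped_metric m k c (param (slab_chart S) y) :: real^'n^'n))"
  proof (intro exI conjI)
    show "open U" by (rule U)
    show "x \<in> U" by (rule inU[OF x])
    show "\<forall>k. Ck_on k (\<lambda>y. A 0 (y $ nix) *\<^sub>R (diagm 1 0 :: real^'n^'n) + B 0 (y $ nix) *\<^sub>R diagm 0 1) U"
    proof (intro allI Ck_on_compose_component U)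
      fix j and y :: "real^'n" assume "y \<in> U"
      then show "(A j has_real_derivative A (Suc j) (y $ nix)) (at (y $ nix))"
        "(B j has_real_derivative B (Suc j) (y $ nix)) (at (y $ nix))"
        unfolding A_def B_def U_def using real_part_higher_deriv hol W by blast+
    qed
    show "\<forall>y\<in>U \<inter> cbx S. A 0 (y $ nix) *\<^sub>R (diagm 1 0 :: real^'n^'n) + B 0 (y $ nix) *\<^sub>R diagm 0 1 =
        warped_metric m k c (param (slab_chart S) y)"
    proof
      fix y assume "y \<in> U \<inter> cbx S"
      then have y: "y \<in> cbx S" by simp
      have "A 0 (y $ nix) = 1 / warp m k N (\<rho> S (y $ nix))"
        unfolding A0 using warp_eq[of "\<rho> S (y $ nix)"] rho_range[OF y] by auto
      then have "warped_metric m k c (param (slab_chart S) y) = (diagm (A 0 (y $ nix)) (B 0 (y $ nix)) :: real^'n^'n)"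
        by (simp add: warped_metric_cpar[OF y] B0 N_def)
      then show "A 0 (y $ nix) *\<^sub>R (diagm 1 0 :: real^'n^'n) + B 0 (y $ nix) *\<^sub>R diagm 0 1 =
        warped_metric m k c (param (slab_chart S) y)"
        by (simp add: diagm_def vec_eq_iff)
    qed
  qed
qed

lemma cpt_nix_range:
  assumes "p \<in> slab_points TYPE('n)"
  shows "1 \<le> Re (cpt p (nix :: 'n))" "Re (cpt p (nix :: 'n)) \<le> 2"
  using assms by (auto simp: slab_points_def slab_def)

lemma riemannian_warped_metric:
  "riemannian_metric (slab_atlas :: (_, 'n) chart set) (warped_metric m k)"
  unfolding riemannian_metric_def
proof (intro conjI ballI)
  fix c assume "c \<in> (slab_atlas :: (_, 'n) chart set)"
  then obtain S where c: "c = slab_chart S" by (auto simp: slab_atlas_def)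
  show "smooth_on (\<lambda>x. warped_metric m k c (param c x)) (cimg c)"
    using smooth_warped_metric[of c S] by (simp add: c cimg_slab_chart)
  fix p assume "p \<in> cdom c"
  then have r: "1 \<le> Re (cpt p (nix :: 'n))" "Re (cpt p (nix :: 'n)) \<le> 2"
    using cpt_nix_range by (auto simp: c cdom_slab_chart)
  show "transpose (warped_metric m k c p) = warped_metric m k c p"
    by (simp add: warped_metric_def transpose_diagm)
  show "\<forall>v. v \<noteq> 0 \<longrightarrow> v \<bullet> (warped_metric m k c p *v v) > 0"
    unfolding warped_metric_def using pos[OF r] r by (auto intro!: diagm_quadratic_pos)
next
  fix c c' :: "(nat \<Rightarrow> real, 'n) chart" and p
  assume "c \<in> slab_atlas" "c' \<in> slab_atlas" "p \<in> cdom c \<inter> cdom c'"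
  then show "warped_metric m k c p =
      transpose (jacobian c c' p) ** warped_metric m k c' p ** jacobian c c' p"
    unfolding warped_metric_def by (rule invariant_diagm_metric)
qed

text \<open>The orientation sign \<open>eps S\<close> enters the scalar curvature only through its
  square, so all charts agree. A single factor survives in the mean curvature, where it
  distinguishes the two ends.\<close>

lemma curvature_in_chart:
  fixes S :: "'n set"
  assumes x: "x \<in> cbx S"
  defines "h \<equiv> \<lambda>x. warped_metric m k (slab_chart S) (param (slab_chart S) x)"
    and "r \<equiv> \<rho> S (x $ nix)"
  shows "scal_coord (cbx S) h x = real CARD('n) * (real CARD('n) - 1) * k"
    and "mean_curv_coord (cbx S) h x =
      - eps S * (real CARD('n) - 1) * sqrt (warp m k (CARD('n) - 2) r) / r"
proof -
  define N where "N = CARD('n) - 2"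
  have N: "real CARD('n) = real N + 2" using card by (simp add: N_def of_nat_diff)
  let ?F = "warp m k N" and ?F' = "warp_deriv m k N"
  let ?F'' = "\<lambda>r. real (Suc N) * (real N * m) / r ^ Suc (Suc N) - 2 * k"
  have ee: "eps S * eps S = 1" "(eps S)\<^sup>2 = 1" by (auto simp: eps_def)
  have F: "?F (\<rho> S (y $ nix)) > 0" "\<rho> S (y $ nix) > 0" if "y \<in> cbx S" for y
    using pos[OF rho_range[OF that]] rho_range[OF that] by (auto simp: N_def)
  have dr: "(\<rho> S has_real_derivative eps S) (at t)" for t
    by (auto intro!: derivative_eq_intros)
  have dF: "((\<lambda>t. ?F (\<rho> S t)) has_real_derivative ?F' (\<rho> S (y $ nix)) * eps S) (at (y $ nix))"
    and dF': "((\<lambda>t. ?F' (\<rho> S t)) has_real_derivative ?F'' (\<rho> S (y $ nix)) * eps S) (at (y $ nix))"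
    if "y \<in> cbx S" for y
    using F(2)[OF that] DERIV_chain2[OF warp_has_derivative dr] DERIV_chain2[OF warp_deriv_has_derivative dr]
    by (metis less_irrefl)+
  let ?al = "\<lambda>t. 1 / ?F (\<rho> S t)" and ?be = "\<lambda>t. (\<rho> S t)\<^sup>2"
  let ?al' = "\<lambda>t. - (?F' (\<rho> S t) * eps S) / (?F (\<rho> S t))\<^sup>2" and ?be' = "\<lambda>t. 2 * \<rho> S t * eps S"
  \<comment> \<open>These are \<alpha>' / (2 \<alpha>), - \<beta>' / (2 \<alpha>) and \<beta>' / (2
    \<beta>) for \<alpha> = 1 / F and \<beta> = r^2, where dr / dt = \<open>eps S\<close>.\<close>
  let ?P = "\<lambda>t. - (eps S * ?F' (\<rho> S t)) / (2 * ?F (\<rho> S t))"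
  let ?Q = "\<lambda>t. - (eps S * \<rho> S t * ?F (\<rho> S t))"
  let ?R = "\<lambda>t. eps S / \<rho> S t"
  \<comment> \<open>Kept as the literal output of the quotient rule; in \<open>?Q'\<close> and
    \<open>?R'\<close> the square of \<open>eps S\<close> is already replaced by 1.\<close>
  let ?P' = "\<lambda>t. (- (eps S * (?F'' (\<rho> S t) * eps S)) * (2 * ?F (\<rho> S t)) -
     - (eps S * ?F' (\<rho> S t)) * (2 * (?F' (\<rho> S t) * eps S))) / (2 * ?F (\<rho> S t) * (2 * ?F (\<rho> S t)))"
  let ?Q' = "\<lambda>t. - (?F (\<rho> S t) + \<rho> S t * ?F' (\<rho> S t))"
  let ?R' = "\<lambda>t. - 1 / (\<rho> S t)\<^sup>2"
  have hyps:
    "\<And>x. x \<in> cbx S \<Longrightarrow> h x = diagm (?al (x $ nix)) (?be (x $ nix))"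
    "\<And>x. x \<in> cbx S \<Longrightarrow> ?al (x $ nix) > 0"
    "\<And>x. x \<in> cbx S \<Longrightarrow> ?be (x $ nix) > 0"
    "\<And>x. x \<in> cbx S \<Longrightarrow> (?al has_real_derivative ?al' (x $ nix)) (at (x $ nix))"
    "\<And>x. x \<in> cbx S \<Longrightarrow> (?be has_real_derivative ?be' (x $ nix)) (at (x $ nix))"
    "\<And>x. x \<in> cbx S \<Longrightarrow> ?al' (x $ nix) = 2 * ?al (x $ nix) * ?P (x $ nix)"
    "\<And>x. x \<in> cbx S \<Longrightarrow> ?be' (x $ nix) = - 2 * ?al (x $ nix) * ?Q (x $ nix)"
    "\<And>x. x \<in> cbx S \<Longrightarrow> ?be' (x $ nix) = 2 * ?be (x $ nix) * ?R (x $ nix)"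
    "\<And>x. x \<in> cbx S \<Longrightarrow> (?P has_real_derivative ?P' (x $ nix)) (at (x $ nix))"
    "\<And>x. x \<in> cbx S \<Longrightarrow> (?Q has_real_derivative ?Q' (x $ nix)) (at (x $ nix))"
    "\<And>x. x \<in> cbx S \<Longrightarrow> (?R has_real_derivative ?R' (x $ nix)) (at (x $ nix))"
    subgoal by (simp add: h_def warped_metric_cpar N_def)
    subgoal for y using F[of y] by simp
    subgoal for y using F[of y] by simp
    subgoal for y using F[of y] by (auto intro!: derivative_eq_intros dF simp: power2_eq_square)
    subgoal for y using F[of y] by (auto intro!: derivative_eq_intros)
    subgoal for y using F[of y] by (simp add: power2_eq_square)
    subgoal for y using F[of y] by simp
    subgoal for y using F[of y] by (simp add: power2_eq_square)
    subgoal for y using F[of y]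
      by (intro DERIV_divide DERIV_minus DERIV_cmult dF dF') auto
    subgoal premises y for y
    proof -
      have "((\<lambda>t. \<rho> S t * ?F (\<rho> S t)) has_real_derivative
          eps S * ?F (\<rho> S (y $ nix)) + ?F' (\<rho> S (y $ nix)) * eps S * \<rho> S (y $ nix)) (at (y $ nix))"
        by (rule DERIV_mult[OF dr dF[OF y]])
      from DERIV_cmult[OF this, of "- eps S"]
      have "((\<lambda>t. - (eps S * \<rho> S t * ?F (\<rho> S t))) has_real_derivative
          - eps S * (eps S * ?F (\<rho> S (y $ nix)) + ?F' (\<rho> S (y $ nix)) * eps S * \<rho> S (y $ nix))) (at (y $ nix))"
        by (simp only: minus_mult_left mult.assoc)
      moreover have "- e * (e * f + g * e * r) = - (f + r * g)" if "e * e = 1" for e f g r :: real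
      proof -
        have "- e * (e * f + g * e * r) = - (e * e) * (f + r * g)" by (simp add: algebra_simps)
        then show ?thesis using that by simp
      qed
      ultimately show ?thesis using ee(1) by simp
    qed
    subgoal for y using F[of y] ee
      by (auto intro!: derivative_eq_intros simp: field_simps power2_eq_square)
    done
  have r: "r > 0" "?F r > 0" using F[OF x] by (auto simp: r_def)
  have "scal_coord (cbx S) h x = (real CARD('n) - 1) *
    ((1 / r\<^sup>2 + eps S / r * (- (eps S * ?F' r) / (2 * ?F r)) - (eps S / r)\<^sup>2) * ?F r +
     (- (?F r + r * ?F' r) + - (eps S * ?F' r) / (2 * ?F r) * - (eps S * r * ?F r)
        + (real CARD('n) - 3) * - (eps S * r * ?F r) * (eps S / r)) / r\<^sup>2)"
    using scal_warped[OF openin_cbx hyps x] by (simp add: r_def)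
  also have "\<dots> = (real CARD('n) - 1) * (- ?F' r / r - real N * ?F r / r\<^sup>2)"
  proof -
    \<comment> \<open>The term 1 / r^2, which is - R', cancels against R^2.\<close>
    have 1: "(1 / r\<^sup>2 + eps S / r * (- (eps S * ?F' r) / (2 * ?F r)) - (eps S / r)\<^sup>2) * ?F r = - ?F' r / (2 * r)"
      using r by (simp add: field_simps power2_eq_square eps_sq)
    have 2: "- (?F r + r * ?F' r) + - (eps S * ?F' r) / (2 * ?F r) * - (eps S * r * ?F r)
        + (real CARD('n) - 3) * - (eps S * r * ?F r) * (eps S / r) = - real N * ?F r - r * ?F' r / 2"
      using r by (simp add: field_simps power2_eq_square N eps_sq)
    show ?thesis unfolding 1 2 using r by (simp add: field_simps power2_eq_square)
  qed
  \<comment> \<open>The terms in \<open>m\<close> cancel; those in \<open>k\<close> give 2 k + N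
    k.\<close>
  also have "- ?F' r / r - real N * ?F r / r\<^sup>2 = real CARD('n) * k"
    using r by (simp add: warp_def warp_deriv_def field_simps power2_eq_square N)
  finally show "scal_coord (cbx S) h x = real CARD('n) * (real CARD('n) - 1) * k" by simp
  have "mean_curv_coord (cbx S) h x =
      (real CARD('n) - 1) * sqrt (1 / ?F r) * - (eps S * r * ?F r) / r\<^sup>2"
    using mean_curv_warped[OF openin_cbx hyps x] by (simp add: r_def)
  also have "\<dots> = - eps S * (real CARD('n) - 1) * (?F r / sqrt (?F r)) / r"
    using r by (simp add: real_sqrt_divide power2_eq_square)
  finally show "mean_curv_coord (cbx S) h x =
      - eps S * (real CARD('n) - 1) * sqrt (warp m k (CARD('n) - 2) r) / r"
    using r(2) by (simp only: real_div_sqrt less_imp_le N_def)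
qed

text \<open>The chart selected by \<open>chart_at\<close> is unspecified, so the curvature formulas
  are needed for every index \<open>S\<close>.\<close>

lemma chart_at_slab:
  assumes "p \<in> slab_points TYPE('n)"
  obtains S :: "'n set" where "chart_at slab_atlas p = slab_chart S" "p \<in> chart_region S"
proof -
  have "\<exists>c. c \<in> (slab_atlas :: (_, 'n) chart set) \<and> p \<in> cdom c"
    using slab_points_covered[OF assms] assms by (auto simp: slab_atlas_def cdom_slab_chart)
  from someI_ex[OF this] have "chart_at slab_atlas p \<in> (slab_atlas :: (_, 'n) chart set)"
    "p \<in> cdom (chart_at slab_atlas p :: (_, 'n) chart)" unfolding chart_at_def by blast+
  then show thesis using that by (auto simp: slab_atlas_def cdom_slab_chart)
qed

lemma scalar_curvature_warped_metric:
  assumes p: "p \<in> slab_points TYPE('n)"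
  shows "scalar_curvature (slab_atlas :: (_, 'n) chart set) (warped_metric m k) p =
    real CARD('n) * (real CARD('n) - 1) * k"
proof -
  obtain S :: "'n set" where S: "chart_at slab_atlas p = slab_chart S" "p \<in> chart_region S"
    using chart_at_slab[OF p] .
  show ?thesis
    using curvature_in_chart(1)[OF ccoord_inverse(1)[OF p S(2)]]
    by (simp add: scalar_curvature_def S(1) cimg_slab_chart)
qed

lemma mean_curvature_warped_metric:
  assumes p: "p \<in> boundary (slab_atlas :: (_, 'n) chart set)"
  shows "mean_curvature (slab_atlas :: (_, 'n) chart set) (warped_metric m k) p =
    (if Re (cpt p (nix :: 'n)) = 1 then - (real CARD('n) - 1) * sqrt (warp m k (CARD('n) - 2) 1)
     else (real CARD('n) - 1) * sqrt (warp m k (CARD('n) - 2) 2) / 2)"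
proof -
  have p': "p \<in> slab_points TYPE('n)" "Re (cpt p (nix :: 'n)) \<in> {1, 2}"
    using p by (auto simp: boundary_slab)
  obtain S :: "'n set" where S: "chart_at slab_atlas p = slab_chart S" "p \<in> chart_region S"
    using chart_at_slab[OF p'(1)] .
  \<comment> \<open>A boundary point lies at the end to which its chart is adapted, so the selected
    chart determines the sign.\<close>
  have r: "Re (cpt p (nix :: 'n)) = base S"
    using S(2) p'(2) by (auto simp: chart_region_def eps_def base_def split: if_splits)
  show ?thesis
    using curvature_in_chart(2)[OF ccoord_inverse(1)[OF p'(1) S(2)]] r
    unfolding cpt_nix_ccoord[of p S, symmetric]
    by (cases "nix \<in> S")
      (simp_all add: mean_curvature_def Let_def S(1) cimg_slab_chart eps_def base_def algebra_simps)
qed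

end


section \<open>The volume measure of the boundary\<close>

text \<open>Arc length on the unit circle, as a measure on the plane. The open interval omits one
  angle, a null set, and matches the angular range of the charts without shift.\<close>

definition circle_measure :: "complex measure" where
  "circle_measure = distr (density lborel (indicator {0<..<2 * pi})) borel cis"

lemma measurable_cis: "cis \<in> borel_measurable borel"
  by (intro borel_measurable_continuous_onI continuous_intros)

lemma emeasure_lborel_insert_point:
  fixes x :: real
  assumes "A \<in> sets borel" "B \<in> sets borel" "A - {x} = B - {x}"
  shows "emeasure lborel A = emeasure lborel B"
proof -
  have "emeasure lborel (C - {x}) = emeasure lborel C" if "C \<in> sets borel" for C
    using that by (intro emeasure_Diff_null_set) auto
  then show ?thesis using assms by metis
qed

text \<open>Arc length is the same for both cuts: up to single points, the interval from pi to 3 pi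
  arises from the one from 0 to 2 pi by moving the half below pi up by a full period.\<close>

lemma emeasure_circle_measure:
  assumes A: "A \<in> sets borel" and b: "b \<in> {0, pi}"
  shows "emeasure circle_measure A = emeasure lborel ({b<..<b + 2 * pi} \<inter> cis -` A)"
proof -
  define E where "E = cis -` A"
  have E: "E \<in> sets borel" using measurable_sets[OF measurable_cis A] by (simp add: E_def)
  have per: "2 * pi + x \<in> E \<longleftrightarrow> x \<in> E" for x
    by (simp add: E_def flip: cis_mult)
  have c: "emeasure circle_measure A = emeasure lborel ({0<..<2 * pi} \<inter> E)"
  proof -
    have "emeasure circle_measure A = emeasure (density lborel (indicator {0<..<2 * pi})) E"
      unfolding circle_measure_def
      by (subst emeasure_distr) (use A measurable_cis in \<open>auto simp: E_def\<close>)
    also have "\<dots> = emeasure lborel ({0<..<2 * pi} \<inter> E)"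
      by (rule emeasure_restricted) (simp_all add: E)
    finally show ?thesis .
  qed
  have "emeasure lborel ({0<..<2 * pi} \<inter> E) = emeasure lborel ({pi<..<pi + 2 * pi} \<inter> E)"
  proof -
    have tr: "emeasure lborel ({2 * pi<..<3 * pi} \<inter> E) = emeasure lborel ({0<..<pi} \<inter> E)"
    proof -
      have "emeasure lborel ({2 * pi<..<3 * pi} \<inter> E) = emeasure (distr lborel borel ((+) (2 * pi))) ({2 * pi<..<3 * pi} \<inter> E)"
        by (simp add: lborel_distr_plus)
      also have "\<dots> = emeasure lborel ((+) (2 * pi) -` ({2 * pi<..<3 * pi} \<inter> E))"
        using E by (subst emeasure_distr) auto
      also have "(+) (2 * pi) -` ({2 * pi<..<3 * pi} \<inter> E) = {0<..<pi} \<inter> E"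
        by (auto simp: per)
      finally show ?thesis .
    qed
    have "emeasure lborel ({0<..<2 * pi} \<inter> E) = emeasure lborel (({0<..<pi} \<inter> E) \<union> ({pi<..<2 * pi} \<inter> E))"
      by (rule emeasure_lborel_insert_point[of _ _ pi]) (use E pi_gt_zero in \<open>auto simp del: pi_gt_zero\<close>)
    also have "\<dots> = emeasure lborel ({0<..<pi} \<inter> E) + emeasure lborel ({pi<..<2 * pi} \<inter> E)"
      using E by (intro plus_emeasure[symmetric]) auto
    also have "\<dots> = emeasure lborel ({2 * pi<..<3 * pi} \<inter> E) + emeasure lborel ({pi<..<2 * pi} \<inter> E)"
      by (simp add: tr)
    also have "\<dots> = emeasure lborel (({2 * pi<..<3 * pi} \<inter> E) \<union> ({pi<..<2 * pi} \<inter> E))"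
      using E by (intro plus_emeasure) auto
    also have "\<dots> = emeasure lborel ({pi<..<pi + 2 * pi} \<inter> E)"
      by (rule emeasure_lborel_insert_point[of _ _ "2 * pi"]) (use E pi_gt_zero in \<open>auto simp del: pi_gt_zero\<close>)
    finally show ?thesis .
  qed
  then show ?thesis using b c by (auto simp: E_def)
qed

lemma finite_circle_measure: "finite_measure circle_measure"
proof
  have "emeasure circle_measure UNIV = emeasure lborel ({0<..<0 + 2 * pi} \<inter> cis -` UNIV)"
    by (rule emeasure_circle_measure) auto
  then show "emeasure circle_measure (space circle_measure) \<noteq> \<infinity>"
    by (simp add: circle_measure_def)
qed

section \<open>Product measures on the torus\<close>

interpretation lborel_product: product_sigma_finite "\<lambda>_. lborel :: real measure"
  by standard

interpretation circle_product: product_sigma_finite "\<lambda>_. circle_measure"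
  by (rule product_sigma_finite.intro) (rule finite_measure.axioms(1)[OF finite_circle_measure])

definition angle_box :: "'n::finite set \<Rightarrow> ('n \<Rightarrow> real) set" where
  "angle_box S = (\<Pi>\<^sub>E i\<in>- {nix}. {shift S i<..<shift S i + 2 * pi})"

abbreviation angle_lborel :: "('n::finite \<Rightarrow> real) measure" where
  "angle_lborel \<equiv> \<Pi>\<^sub>M i\<in>- {nix}. lborel"

definition angle_measure :: "'n::finite set \<Rightarrow> ('n \<Rightarrow> real) measure" where
  "angle_measure S = density angle_lborel (indicator (angle_box S))"

definition cis_map :: "('n::finite \<Rightarrow> real) \<Rightarrow> 'n \<Rightarrow> complex" where
  "cis_map f = (\<lambda>i\<in>- {nix}. cis (f i))"

lemma angle_box_sets: "angle_box S \<in> sets angle_lborel"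
  unfolding angle_box_def by (intro sets_PiM_I_finite) auto

lemma measurable_cis_map: "cis_map \<in> measurable angle_lborel (\<Pi>\<^sub>M i\<in>- {nix}. borel)"
  unfolding cis_map_def
  by (intro measurable_restrict measurable_compose[OF measurable_component_singleton]) (auto simp: measurable_cis)

lemma emeasure_angle_measure:
  assumes "A \<in> sets angle_lborel"
  shows "emeasure (angle_measure S) A = emeasure angle_lborel (angle_box S \<inter> A)"
  unfolding angle_measure_def by (rule emeasure_restricted[OF angle_box_sets assms])

text \<open>The right-hand side does not mention \<open>S\<close>: after passage to the torus, all
  choices of cuts give the same measure. On rectangles this splits into one statement about the
  circle for each factor.\<close>

lemma distr_angle_measure:
  "distr (angle_measure S) (\<Pi>\<^sub>M i\<in>- {nix}. borel) cis_map = (\<Pi>\<^sub>M i\<in>- {nix}. circle_measure)"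
proof (rule circle_product.PiM_eqI)
  show "sets (distr (angle_measure S) (\<Pi>\<^sub>M i\<in>- {nix}. borel) cis_map) = sets (\<Pi>\<^sub>M i\<in>- {nix}. circle_measure)"
    by (auto simp: circle_measure_def intro!: sets_PiM_cong)
  fix A :: "'a \<Rightarrow> complex set"
  assume "\<And>i. i \<in> - {nix} \<Longrightarrow> A i \<in> sets circle_measure"
  then have A: "A i \<in> sets borel" if "i \<noteq> nix" for i using that by (auto simp: circle_measure_def)
  have PA: "Pi\<^sub>E (- {nix}) A \<in> sets (\<Pi>\<^sub>M i\<in>- {nix}. borel)"
    using A by (intro sets_PiM_I_finite) auto
  have "emeasure (distr (angle_measure S) (\<Pi>\<^sub>M i\<in>- {nix}. borel) cis_map) (Pi\<^sub>E (- {nix}) A) =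
      emeasure (angle_measure S) (cis_map -` Pi\<^sub>E (- {nix}) A \<inter> space angle_lborel)"
    using PA measurable_cis_map by (subst emeasure_distr) (auto simp: angle_measure_def)
  also have "\<dots> = emeasure angle_lborel (angle_box S \<inter> (cis_map -` Pi\<^sub>E (- {nix}) A \<inter> space angle_lborel))"
    by (rule emeasure_angle_measure[OF measurable_sets[OF measurable_cis_map PA]])
  also have "angle_box S \<inter> (cis_map -` Pi\<^sub>E (- {nix}) A \<inter> space angle_lborel) =
      (\<Pi>\<^sub>E i\<in>- {nix}. {shift S i<..<shift S i + 2 * pi} \<inter> cis -` A i)"
    by (auto simp: angle_box_def cis_map_def space_PiM PiE_iff extensional_def)
  also have "emeasure angle_lborel \<dots> = (\<Prod>i\<in>- {nix}. emeasure lborel ({shift S i<..<shift S i + 2 * pi} \<inter> cis -` A i))"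
    using measurable_sets[OF measurable_cis A] by (intro lborel_product.emeasure_PiM) auto
  also have "\<dots> = (\<Prod>i\<in>- {nix}. emeasure circle_measure (A i))"
    by (intro prod.cong refl emeasure_circle_measure[symmetric] A) (auto simp: shift_def)
  finally show "emeasure (distr (angle_measure S) (\<Pi>\<^sub>M i\<in>- {nix}. borel) cis_map) (Pi\<^sub>E (- {nix}) A) =
    (\<Prod>i\<in>- {nix}. emeasure circle_measure (A i))" .
qed simp

section \<open>The two end tori and the measure on their union\<close>

definition end_point :: "real \<Rightarrow> ('n::finite \<Rightarrow> complex) \<Rightarrow> nat \<Rightarrow> real" where
  "end_point r z = emb (\<lambda>i. if i = nix then of_real r else z i)"

lemma measurable_end_point: "end_point r \<in> borel_measurable (\<Pi>\<^sub>M i\<in>- {nix :: 'n::finite}. borel)"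
proof -
  have "(\<lambda>z. end_point r z m) \<in> borel_measurable (\<Pi>\<^sub>M i\<in>- {nix :: 'n}. borel)" for m
  proof -
    have "(\<lambda>z. if i = nix then of_real r else z i) \<in> borel_measurable (\<Pi>\<^sub>M i\<in>- {nix :: 'n}. borel :: complex measure)" for i :: 'n
      by (cases "i = nix") auto
    then show ?thesis
      unfolding end_point_def emb_def
      by (cases "even m"; cases "m div 2 \<in> range (ix :: 'n \<Rightarrow> nat)") (simp_all del: range_eqI rangeI)
  qed
  then show ?thesis by (rule measurable_coordinatewise_then_product)
qed

lemma end_point_in_boundary:
  fixes f :: "'n::finite \<Rightarrow> real"
  assumes "r \<in> {1, 2}"
  shows "end_point r (cis_map f) \<in> boundary (slab_atlas :: (_, 'n) chart set)"
  using assms by (auto simp: boundary_slab slab_points_def slab_def end_point_def cis_map_def)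

definition boundary_borel :: "'n::finite itself \<Rightarrow> (nat \<Rightarrow> real) measure" where
  "boundary_borel t = restrict_space borel (boundary (slab_atlas :: (_, 'n) chart set))"

text \<open>Lebesgue measure in the angles on each end torus, weighted by r^(n-1), the volume
  density of r^2 dx^2. The empty index set fixes one choice of cuts.\<close>

definition slab_boundary_measure :: "'n::finite itself \<Rightarrow> (nat \<Rightarrow> real) measure" where
  "slab_boundary_measure t =
     distr (point_measure {1, 2} (\<lambda>r. ennreal (r ^ (CARD('n) - 1))) \<Otimes>\<^sub>M angle_measure ({} :: 'n set))
       (boundary_borel t) (\<lambda>(r, f). end_point r (cis_map f))"

lemma closed_boundary_slab: "boundary (slab_atlas :: (_, 'n::finite) chart set) \<in> sets borel"
proof -
  have "closed (slab_points TYPE('n))"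
    using slab_points_compact_connected(1) by (rule compact_imp_closed)
  moreover have "closed {p. Re (cpt p (nix :: 'n)) = 1}" "closed {p. Re (cpt p (nix :: 'n)) = 2}"
    by (intro closed_Collect_eq continuous_intros continuous_cpt)+
  moreover have "boundary (slab_atlas :: (_, 'n) chart set) = slab_points TYPE('n) \<inter>
      ({p. Re (cpt p (nix :: 'n)) = 1} \<union> {p. Re (cpt p (nix :: 'n)) = 2})"
    by (auto simp: boundary_slab)
  ultimately show ?thesis by (metis borel_closed closed_Int closed_Un)
qed

lemma sets_boundary_borel:
  "B \<in> sets (boundary_borel TYPE('n::finite)) \<longleftrightarrow>
    B \<in> sets borel \<and> B \<subseteq> boundary (slab_atlas :: (_, 'n) chart set)"
  unfolding boundary_borel_def using closed_boundary_slab[where 'n = 'n]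
  by (subst sets_restrict_space_iff) auto

lemma finite_angle_measure:
  "emeasure (angle_measure S) (space (angle_measure S)) = ennreal ((2 * pi) ^ (CARD('n) - 1))"
  for S :: "'n::finite set"
proof -
  have "emeasure (angle_measure S) (space angle_lborel) = emeasure angle_lborel (angle_box S)"
    using emeasure_angle_measure[OF sets.top, of S] angle_box_sets[of S]
    by (simp add: Int_absorb2 sets.sets_into_space)
  also have "\<dots> = (\<Prod>i\<in>- {nix :: 'n}. emeasure lborel {shift S i<..<shift S i + 2 * pi})"
    unfolding angle_box_def by (intro lborel_product.emeasure_PiM) auto
  also have "\<dots> = (\<Prod>i\<in>- {nix :: 'n}. ennreal (2 * pi))" by simp
  also have "\<dots> = ennreal ((2 * pi) ^ (CARD('n) - 1))"
    by (simp only: prod_constant card_compl_nix) (rule ennreal_power, simp)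
  finally show ?thesis by (simp add: angle_measure_def)
qed

lemma sigma_finite_angle_measure: "sigma_finite_measure (angle_measure S)"
proof -
  have "finite_measure (angle_measure S)"
    by standard (simp only: finite_angle_measure ennreal_neq_top not_False_eq_True infinity_ennreal_def)
  then show ?thesis by (simp add: finite_measure_def)
qed

lemma measurable_end_point_pair:
  "(\<lambda>(r, f). end_point r (cis_map f)) \<in>
     measurable (point_measure {1, 2} w \<Otimes>\<^sub>M angle_measure ({} :: 'n::finite set)) (boundary_borel TYPE('n))"
proof -
  have "(\<lambda>(r, f). end_point r (cis_map f)) \<in>
     measurable (count_space {1, 2} \<Otimes>\<^sub>M (angle_lborel :: ('n \<Rightarrow> real) measure)) (boundary_borel TYPE('n))"
  proof (rule measurable_pair_measure_countable1)
    fix r :: real assume r: "r \<in> {1, 2}"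
    have "(\<lambda>f. end_point r (cis_map f)) \<in> borel_measurable (angle_lborel :: ('n \<Rightarrow> real) measure)"
      by (rule measurable_compose[OF measurable_cis_map measurable_end_point])
    then show "(\<lambda>y. case (r, y) of (r, f) \<Rightarrow> end_point r (cis_map f)) \<in>
        measurable (angle_lborel :: ('n \<Rightarrow> real) measure) (boundary_borel TYPE('n))"
      unfolding boundary_borel_def using end_point_in_boundary[OF r]
      unfolding prod.case by (intro measurable_restrict_space2) auto
  qed simp
  moreover have "sets (point_measure {1, 2} w \<Otimes>\<^sub>M angle_measure ({} :: 'n set)) =
      sets (count_space {1, 2} \<Otimes>\<^sub>M (angle_lborel :: ('n \<Rightarrow> real) measure))"
    by (intro sets_pair_measure_cong) (simp_all add: angle_measure_def sets_point_measure)
  ultimately show ?thesis using measurable_cong_sets[OF _ refl] by blast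
qed

lemma emeasure_slab_boundary_measure:
  fixes S :: "'n::finite set"
  assumes B: "B \<in> sets (boundary_borel TYPE('n))"
  shows "emeasure (slab_boundary_measure TYPE('n)) B =
    (\<Sum>r\<in>{1, 2}. ennreal (r ^ (CARD('n) - 1)) *
       emeasure (angle_measure S) {f \<in> space angle_lborel. end_point r (cis_map f) \<in> B})"
proof -
  interpret A: sigma_finite_measure "angle_measure ({} :: 'n set)" by (rule sigma_finite_angle_measure)
  let ?P = "point_measure {1, 2} (\<lambda>r::real. ennreal (r ^ (CARD('n) - 1)))"
  let ?J = "\<lambda>(r, f). end_point r (cis_map f)"
  let ?V = "?J -` B \<inter> space (?P \<Otimes>\<^sub>M angle_measure ({} :: 'n set))"
  \<comment> \<open>The set of angles is the preimage of a subset of the torus, where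
    \<open>distr_angle_measure\<close> removes the dependence on \<open>S\<close>.\<close>
  have indep: "emeasure (angle_measure ({} :: 'n set)) {f \<in> space angle_lborel. end_point r (cis_map f) \<in> B} =
      emeasure (angle_measure S) {f \<in> space angle_lborel. end_point r (cis_map f) \<in> B}" for r
  proof -
    let ?G = "end_point r -` B \<inter> space (\<Pi>\<^sub>M i\<in>- {nix :: 'n}. borel)"
    have G: "?G \<in> sets (\<Pi>\<^sub>M i\<in>- {nix :: 'n}. borel)"
      using B measurable_end_point[where 'n = 'n] by (auto simp: sets_boundary_borel intro: measurable_sets)
    have "emeasure (angle_measure S') {f \<in> space angle_lborel. end_point r (cis_map f) \<in> B} =
        emeasure (\<Pi>\<^sub>M i\<in>- {nix :: 'n}. circle_measure) ?G" for S' :: "'n set"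
    proof -
      have m: "cis_map \<in> measurable (angle_measure S') (\<Pi>\<^sub>M i\<in>- {nix :: 'n}. borel)"
        using measurable_cis_map by (simp add: angle_measure_def)
      have "cis_map -` ?G \<inter> space (angle_measure S') = {f \<in> space angle_lborel. end_point r (cis_map f) \<in> B}"
        using measurable_space[OF measurable_cis_map] by (auto simp: angle_measure_def)
      then show ?thesis
        by (simp add: distr_angle_measure[of S', symmetric] emeasure_distr[OF m G])
    qed
    then show ?thesis by simp
  qed
  have "emeasure (slab_boundary_measure TYPE('n)) B = emeasure (?P \<Otimes>\<^sub>M angle_measure {}) ?V"
    unfolding slab_boundary_measure_def by (rule emeasure_distr[OF measurable_end_point_pair B])
  also have "\<dots> = (\<integral>\<^sup>+r. emeasure (angle_measure {}) (Pair r -` ?V) \<partial>?P)"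
    by (rule A.emeasure_pair_measure_alt[OF measurable_sets[OF measurable_end_point_pair B]])
  also have "\<dots> = (\<Sum>r\<in>{1, 2}. ennreal (r ^ (CARD('n) - 1)) * emeasure (angle_measure {}) (Pair r -` ?V))"
    by (rule nn_integral_point_measure_finite) auto
  also have "\<dots> = (\<Sum>r\<in>{1, 2}. ennreal (r ^ (CARD('n) - 1)) *
       emeasure (angle_measure ({} :: 'n set)) {f \<in> space angle_lborel. end_point r (cis_map f) \<in> B})"
  proof (rule sum.cong[OF refl])
    fix r :: real assume "r \<in> {1, 2}"
    then have "Pair r -` ?V = {f \<in> space angle_lborel. end_point r (cis_map f) \<in> B}"
      by (auto simp: space_pair_measure space_point_measure angle_measure_def)
    then show "ennreal (r ^ (CARD('n) - 1)) * emeasure (angle_measure {}) (Pair r -` ?V) =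
      ennreal (r ^ (CARD('n) - 1)) *
       emeasure (angle_measure ({} :: 'n set)) {f \<in> space angle_lborel. end_point r (cis_map f) \<in> B}"
      by simp
  qed
  finally show ?thesis by (simp only: indep)
qed

text \<open>A chart meets the end r = \<open>base S\<close> only. There the density is the constant
  \<open>base S ^ (CARD('n) - 1)\<close>, and the summand of the other end vanishes because no point
  of \<open>B\<close> lies on it.\<close>

lemma slab_boundary_measure_chart:
  fixes S :: "'n::finite set"
  assumes B: "B \<in> sets (boundary_borel TYPE('n))" "B \<subseteq> cdom (slab_chart S)"
  shows "emeasure (slab_boundary_measure TYPE('n)) B =
    (\<integral>\<^sup>+x. ennreal (sqrt (det (boundary_metric (warped_metric m k) (slab_chart S) (param (slab_chart S) x)))) *
       indicator (coord (slab_chart S) ` B) x \<partial>hyperplane_lborel)"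
proof -
  let ?vec = "\<lambda>f :: 'n \<Rightarrow> real. (\<chi> i. if i = nix then 0 else f i) :: real^'n"
  let ?w = "ennreal (base S ^ (CARD('n) - 1))"
  have Bb: "B \<in> sets borel" "B \<subseteq> boundary (slab_atlas :: (_, 'n) chart set)" "B \<subseteq> chart_region S"
    using B by (auto simp: sets_boundary_borel cdom_slab_chart)
  have rad: "Re (cpt p (nix :: 'n)) = base S" if "p \<in> B" for p
  proof -
    have "Re (cpt p (nix :: 'n)) \<in> {1, 2}" "p \<in> chart_region S" using that Bb by (auto simp: boundary_slab)
    then show ?thesis by (auto simp: chart_region_def eps_def base_def split: if_splits)
  qed
  have img: "ccoord S ` B = cbx S \<inter> cpar S -` B"
  proof (intro equalityI subsetI)
    fix x assume "x \<in> ccoord S ` B"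
    then obtain p where p: "p \<in> B" "x = ccoord S p" by blast
    then have "p \<in> slab_points TYPE('n)" "p \<in> chart_region S" using Bb by (auto simp: boundary_slab)
    from ccoord_inverse[OF this] show "x \<in> cbx S \<inter> cpar S -` B" using p by auto
  next
    fix x assume "x \<in> cbx S \<inter> cpar S -` B"
    then show "x \<in> ccoord S ` B" by (intro image_eqI[of _ _ "cpar S x"]) (auto simp: ccoord_cpar)
  qed
  have imgs: "ccoord S ` B \<in> sets borel"
  proof -
    have "cpar S \<in> borel_measurable borel" by (intro borel_measurable_continuous_onI continuous_cpar)
    then have "cpar S -` B \<in> sets borel" using Bb(1) measurable_sets[of "cpar S" borel borel B] by simp
    moreover obtain U where "open U" "cbx S = half_space \<inter> U"
      using openin_cbx[of S] by (auto simp: openin_open)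
    moreover have "closed (half_space :: (real^'n) set)"
      unfolding half_space_def by (intro closed_Collect_le continuous_intros)
    ultimately show ?thesis unfolding img by auto
  qed
  have dens: "ennreal (sqrt (det (boundary_metric (warped_metric m k) (slab_chart S) (param (slab_chart S) x)))) *
       indicator (ccoord S ` B) x = ?w * indicator (ccoord S ` B) x" for x
  proof (cases "x \<in> ccoord S ` B")
    case True
    then have x: "x \<in> cbx S" "cpar S x \<in> B" unfolding img by auto
    \<comment> \<open>\<open>tangential\<close> replaces the radial entry, which contains
      \<open>m\<close> and \<open>k\<close>, by 1.\<close>
    have "det (boundary_metric (warped_metric m k) (slab_chart S) (param (slab_chart S) x)) = ((base S)\<^sup>2) ^ (CARD('n) - 1)"
      using rad[OF x(2)]
      by (simp add: boundary_metric_def warped_metric_def tangential_diagm det_diagm param_slab_chart[OF x(1)])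
    also have "\<dots> = (base S ^ (CARD('n) - 1))\<^sup>2" by (simp add: power_mult[symmetric] mult.commute)
    finally show ?thesis by (simp add: base_def)
  qed simp
  have vm: "?vec \<in> borel_measurable (angle_lborel :: ('n \<Rightarrow> real) measure)"
  proof (rule borel_measurable_euclidean_space[THEN iffD2], intro ballI)
    fix b :: "real^'n" assume "b \<in> Basis"
    then obtain i where "b = axis i 1" by (auto simp: Basis_vec_def)
    then show "(\<lambda>f. ?vec f \<bullet> b) \<in> borel_measurable (angle_lborel :: ('n \<Rightarrow> real) measure)"
      by (cases "i = nix") (simp_all add: inner_axis)
  qed
  have "(\<integral>\<^sup>+x. ?w * indicator (ccoord S ` B) x \<partial>hyperplane_lborel) = ?w * emeasure hyperplane_lborel (ccoord S ` B)"
    using imgs by (intro nn_integral_cmult_indicator) (simp add: hyperplane_lborel_def)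
  also have "emeasure hyperplane_lborel (ccoord S ` B) =
      emeasure angle_lborel (?vec -` (ccoord S ` B) \<inter> space angle_lborel)"
    unfolding hyperplane_lborel_def by (rule emeasure_distr[OF vm imgs])
  also have "?vec -` (ccoord S ` B) \<inter> space angle_lborel =
      angle_box S \<inter> {f \<in> space angle_lborel. end_point (base S) (cis_map f) \<in> B}"
  proof -
    \<comment> \<open>\<open>?vec\<close> puts 0 into the distinguished coordinate, where the
      parametrization has radius \<open>base S\<close>.\<close>
    have "cpar S (?vec f) = end_point (base S) (cis_map f)" for f
      unfolding cpar_def end_point_def
      by (rule arg_cong[of _ _ emb]) (auto simp: wrap_def cis_map_def)
    moreover have "?vec f \<in> cbx S \<longleftrightarrow> f \<in> angle_box S" if "f \<in> space angle_lborel" for f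
      using that by (auto simp: cbx_def angle_box_def space_PiM PiE_iff)
    ultimately show ?thesis unfolding img by auto
  qed
  also have "emeasure angle_lborel \<dots> =
      emeasure (angle_measure S) {f \<in> space angle_lborel. end_point (base S) (cis_map f) \<in> B}"
  proof (rule emeasure_angle_measure[symmetric])
    have "(\<lambda>f. end_point (base S) (cis_map f)) \<in> borel_measurable (angle_lborel :: ('n \<Rightarrow> real) measure)"
      by (rule measurable_compose[OF measurable_cis_map measurable_end_point])
    from measurable_sets[OF this Bb(1)]
    show "{f \<in> space angle_lborel. end_point (base S) (cis_map f) \<in> B} \<in> sets (angle_lborel :: ('n \<Rightarrow> real) measure)"
      by (simp add: vimage_def Int_def conj_commute)
  qed
  also have "?w * \<dots> = emeasure (slab_boundary_measure TYPE('n)) B"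
  proof -
    have "r = base S" if "end_point r (cis_map f) \<in> B" for r and f :: "'n \<Rightarrow> real"
      using rad[OF that] by (simp add: end_point_def)
    then have e: "{f \<in> space (angle_lborel :: ('n \<Rightarrow> real) measure). end_point r (cis_map f) \<in> B} = {}"
      if "r \<noteq> base S" for r
      using that by blast
    have "ennreal (r ^ (CARD('n) - 1)) *
        emeasure (angle_measure S) {f \<in> space angle_lborel. end_point r (cis_map f) \<in> B} = 0"
      if "r \<noteq> base S" for r
      by (simp only: e[OF that] emeasure_empty mult_zero_right)
    moreover have "base S \<in> {1, 2}" by (simp add: base_def)
    ultimately show ?thesis
      unfolding emeasure_slab_boundary_measure[OF B(1), of S]
      by (intro sum.remove[of _ "base S", THEN trans, symmetric]) (auto intro!: sum.neutral)
  qed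
  finally show ?thesis by (simp add: dens)
qed

text \<open>Additivity reduces a set covered by several pieces to its intersection with one piece
  and a remainder covered by the others.\<close>

lemma measure_eqI_finite_cover:
  assumes sets: "sets M = sets N" and I: "finite I" "\<And>i. i \<in> I \<Longrightarrow> D i \<in> sets M"
    and cover: "space M \<subseteq> (\<Union>i\<in>I. D i)"
    and eq: "\<And>i B. i \<in> I \<Longrightarrow> B \<in> sets M \<Longrightarrow> B \<subseteq> D i \<Longrightarrow> emeasure M B = emeasure N B"
  shows "M = N"
proof (rule measure_eqI[OF sets])
  fix B assume B: "B \<in> sets M"
  have "emeasure M B = emeasure N B" if "B \<in> sets M" "B \<subseteq> (\<Union>i\<in>J. D i)" "J \<subseteq> I" for J B
    using finite_subset[OF that(3) I(1)] that
  proof (induction J arbitrary: B rule: finite_induct)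
    case empty
    then show ?case by simp
  next
    case (insert j J)
    have D: "D j \<in> sets M" using insert.prems I(2) by auto
    have "emeasure K B = emeasure K (B \<inter> D j) + emeasure K (B - D j)" if "sets K = sets M" for K
      using D insert.prems(1) that by (subst plus_emeasure) (auto simp: Int_Diff_Un)
    from this[of M] this[of N] show ?case
      using D insert.prems insert.IH[of "B - D j"] eq[of j "B \<inter> D j"] sets by auto
  qed
  from this[OF B, of I] show "emeasure M B = emeasure N B"
    using sets.sets_into_space[OF B] cover by blast
qed

lemma sigma_sets_boundary:
  "sigma_sets (boundary (slab_atlas :: (_, 'n::finite) chart set))
     {U. openin (subtopology (slab_top TYPE('n)) (boundary (slab_atlas :: (_, 'n) chart set))) U} =
   sets (boundary_borel TYPE('n))"
proof -
  let ?b = "boundary (slab_atlas :: (_, 'n) chart set)"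
  have "subtopology (slab_top TYPE('n)) ?b = top_of_set ?b"
    by (auto simp: slab_top_def subtopology_subtopology boundary_slab intro!: arg_cong[of _ _ top_of_set])
  then have "{U. openin (subtopology (slab_top TYPE('n)) ?b) U} = (\<inter>) ?b ` {U. open U}"
    by (auto simp: openin_open)
  moreover have "sets borel = sigma_sets UNIV {U :: (nat \<Rightarrow> real) set. open U}"
    by (simp add: borel_def sets_measure_of)
  ultimately show ?thesis
    using closed_boundary_slab[where 'n = 'n]
    by (simp add: boundary_borel_def sets_restrict_space sigma_sets_Int)
qed

text \<open>The measure constructed above satisfies the defining formula in each chart. It is the
  only such measure, since the formula prescribes the values inside each of the finitely many chart
  domains, and these cover the boundary.\<close>

lemma boundary_volume_slab:
  "boundary_volume (slab_top TYPE('n::finite)) (slab_atlas :: (_, 'n) chart set) (warped_metric m k) =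
     slab_boundary_measure TYPE('n)"
  unfolding boundary_volume_def sigma_sets_boundary
proof (rule the_equality)
  let ?b = "boundary (slab_atlas :: (_, 'n) chart set)"
  show "space (slab_boundary_measure TYPE('n)) = ?b \<and>
    sets (slab_boundary_measure TYPE('n)) = sets (boundary_borel TYPE('n)) \<and>
    (\<forall>c\<in>(slab_atlas :: (_, 'n) chart set). \<forall>B\<in>sets (slab_boundary_measure TYPE('n)). B \<subseteq> cdom c \<longrightarrow>
      emeasure (slab_boundary_measure TYPE('n)) B =
      (\<integral>\<^sup>+x. ennreal (sqrt (det (boundary_metric (warped_metric m k) c (param c x)))) *
         indicator (coord c ` B) x \<partial>hyperplane_lborel))"
    using slab_boundary_measure_chart[where 'n = 'n]
    by (auto simp: slab_atlas_def slab_boundary_measure_def boundary_borel_def space_restrict_space simp del: coord_slab_chart)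
next
  let ?b = "boundary (slab_atlas :: (_, 'n) chart set)"
  fix \<mu>
  assume \<mu>: "space \<mu> = ?b \<and> sets \<mu> = sets (boundary_borel TYPE('n)) \<and>
    (\<forall>c\<in>(slab_atlas :: (_, 'n) chart set). \<forall>B\<in>sets \<mu>. B \<subseteq> cdom c \<longrightarrow>
      emeasure \<mu> B =
      (\<integral>\<^sup>+x. ennreal (sqrt (det (boundary_metric (warped_metric m k) c (param c x)))) *
         indicator (coord c ` B) x \<partial>hyperplane_lborel))"
  show "\<mu> = slab_boundary_measure TYPE('n)"
  proof (rule measure_eqI_finite_cover[where I = "UNIV :: 'n set set" and D = "\<lambda>S. ?b \<inter> chart_region S"])
    show "sets \<mu> = sets (slab_boundary_measure TYPE('n))" using \<mu> by (simp add: slab_boundary_measure_def)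
    show "?b \<inter> chart_region S \<in> sets \<mu>" for S :: "'n set"
      using \<mu> closed_boundary_slab[where 'n = 'n] open_chart_region[of S] by (auto simp: sets_boundary_borel)
    show "space \<mu> \<subseteq> (\<Union>S :: 'n set. ?b \<inter> chart_region S)"
      using \<mu> slab_points_covered[where 'n = 'n] by (auto simp: boundary_slab)
    fix S :: "'n set" and B
    assume B: "B \<in> sets \<mu>" "B \<subseteq> ?b \<inter> chart_region S"
    then have c: "B \<subseteq> cdom (slab_chart S)" by (auto simp: cdom_slab_chart boundary_slab)
    have "slab_chart S \<in> slab_atlas" by (simp add: slab_atlas_def)
    with \<mu> B c show "emeasure \<mu> B = emeasure (slab_boundary_measure TYPE('n)) B"
      using slab_boundary_measure_chart[of B S m k] by (simp del: coord_slab_chart)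
  qed simp
qed

text \<open>A function of the radius takes at most two values on the boundary; they are weighted by
  the volumes of the end tori of radii 1 and 2.\<close>

lemma integral_slab_boundary:
  fixes h :: "real \<Rightarrow> real"
  shows "(\<integral>p. h (Re (cpt p (nix :: 'n::finite))) \<partial>slab_boundary_measure TYPE('n)) =
    (h 1 + h 2 * 2 ^ (CARD('n) - 1)) * (2 * pi) ^ (CARD('n) - 1)"
proof -
  let ?\<mu> = "slab_boundary_measure TYPE('n)" and ?b = "boundary (slab_atlas :: (_, 'n) chart set)"
  define E where "E = (\<lambda>r. {p \<in> ?b. Re (cpt p (nix :: 'n)) = r})"
  have E: "E r \<in> sets (boundary_borel TYPE('n))" for r
  proof -
    have "closed {p. Re (cpt p (nix :: 'n)) = r}"
      by (intro closed_Collect_eq continuous_intros continuous_cpt)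
    then have "?b \<inter> {p. Re (cpt p (nix :: 'n)) = r} \<in> sets borel"
      using closed_boundary_slab[where 'n = 'n] by auto
    then show ?thesis by (auto simp: E_def sets_boundary_borel Int_def)
  qed
  have eE: "emeasure ?\<mu> (E r) = ennreal (r ^ (CARD('n) - 1) * (2 * pi) ^ (CARD('n) - 1))" if r: "r \<in> {1, 2}" for r
  proof -
    have "{f \<in> space angle_lborel. end_point r' (cis_map f) \<in> E r} =
        (if r' = r then space (angle_lborel :: ('n \<Rightarrow> real) measure) else {})" if "r' \<in> {1, 2}" for r'
      using end_point_in_boundary[OF that, where 'n = 'n] by (auto simp: E_def) (auto simp: end_point_def)
    then have "emeasure ?\<mu> (E r) = ennreal (r ^ (CARD('n) - 1)) *
        emeasure (angle_measure ({} :: 'n set)) (space (angle_measure ({} :: 'n set)))"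
      unfolding emeasure_slab_boundary_measure[OF E, of r "{}"]
      using r by (auto simp: angle_measure_def)
    also have "\<dots> = ennreal (r ^ (CARD('n) - 1) * (2 * pi) ^ (CARD('n) - 1))"
      unfolding finite_angle_measure using r by (intro ennreal_mult[symmetric]) auto
    finally show ?thesis .
  qed
  have mE: "measure ?\<mu> (E r) = r ^ (CARD('n) - 1) * (2 * pi) ^ (CARD('n) - 1)" if "r \<in> {1, 2}" for r
    using eE[OF that] that by (auto simp: measure_def)
  have s: "E r \<in> sets ?\<mu>" for r using E by (simp add: slab_boundary_measure_def)
  have "(\<integral>p. h (Re (cpt p (nix :: 'n))) \<partial>?\<mu>) = (\<integral>p. h 1 * indicator (E 1) p + h 2 * indicator (E 2) p \<partial>?\<mu>)"
    by (rule Bochner_Integration.integral_cong[OF refl])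
      (auto simp: slab_boundary_measure_def boundary_borel_def space_restrict_space E_def boundary_slab)
  also have "\<dots> = h 1 * measure ?\<mu> (E 1) + h 2 * measure ?\<mu> (E 2)"
    using s eE by (subst Bochner_Integration.integral_add) (auto simp: less_top[symmetric])
  finally show ?thesis by (simp add: mE algebra_simps)
qed


section \<open>The limit of collapsing metrics\<close>

text \<open>By subadditivity of the root, the end 1 costs at most 1 / a plus a constant. The end 2
  gains 2^N sqrt (F 2), whose square 2^N (m - 2^(N+2) \<kappa>) is at least 2 / a^2 because N is at
  least 1. As 7 / 5 is less than sqrt 2, the gain is at least 7 / 5 / a, and 2 / 5 / a
  remains.\<close>

lemma total_mean_curvature_limit:
  fixes \<kappa> :: real
  assumes "N \<ge> 1"
  defines "m \<equiv> \<lambda>a::real. 1 / a\<^sup>2 + 2 ^ (N + 2) * \<bar>\<kappa>\<bar>"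
  shows "filterlim (\<lambda>a. - sqrt (warp (m a) \<kappa> N 1) + sqrt (warp (m a) \<kappa> N 2) / 2 * 2 ^ (N + 1)) at_top (at_right 0)"
proof (rule filterlim_at_top_mono)
  let ?L = "2 ^ (N + 2) * \<bar>\<kappa>\<bar> + \<bar>\<kappa>\<bar>"
  show "filterlim (\<lambda>a. 2 / 5 / a - sqrt ?L) at_top (at_right 0)" by real_asymp
  show "\<forall>\<^sub>F a in at_right 0. 2 / 5 / a - sqrt ?L \<le>
      - sqrt (warp (m a) \<kappa> N 1) + sqrt (warp (m a) \<kappa> N 2) / 2 * 2 ^ (N + 1)"
  proof (rule eventually_at_right_less[THEN eventually_mono])
    fix a :: real assume a: "0 < a"
    have "sqrt (warp (m a) \<kappa> N 1) \<le> sqrt (1 / a\<^sup>2 + ?L)"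
      by (intro real_sqrt_le_mono) (simp add: warp_def m_def)
    also have "\<dots> \<le> sqrt (1 / a\<^sup>2) + sqrt ?L"
      by (rule sqrt_add_le_add_sqrt) auto
    also have "sqrt (1 / a\<^sup>2) = 1 / a" using a by (simp add: real_sqrt_divide)
    finally have 1: "sqrt (warp (m a) \<kappa> N 1) \<le> 1 / a + sqrt ?L" .
    have "(7 / 5 / a)\<^sup>2 \<le> 2 ^ N / a\<^sup>2"
    proof -
      have "(2::real) ^ 1 \<le> 2 ^ N" using assms(1) by (intro power_increasing) auto
      then have "49 / 25 / a\<^sup>2 \<le> 2 ^ N / a\<^sup>2" by (intro divide_right_mono) auto
      then show ?thesis by (simp add: power_divide)
    qed
    also have "\<dots> \<le> 2 ^ N * (m a - 2 ^ (N + 2) * \<kappa>)"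
    proof -
      have "2 ^ (N + 2) * \<kappa> \<le> 2 ^ (N + 2) * \<bar>\<kappa>\<bar>" by (intro mult_left_mono) auto
      then have "1 / a\<^sup>2 \<le> m a - 2 ^ (N + 2) * \<kappa>" by (simp add: m_def)
      from mult_left_mono[OF this, of "2 ^ N"] show ?thesis by simp
    qed
    also have "\<dots> = (2 ^ N)\<^sup>2 * warp (m a) \<kappa> N 2"
      by (simp add: warp_def power2_eq_square field_simps)
    finally have "7 / 5 / a \<le> sqrt ((2 ^ N)\<^sup>2 * warp (m a) \<kappa> N 2)" by (rule real_le_rsqrt)
    also have "\<dots> = sqrt (warp (m a) \<kappa> N 2) / 2 * 2 ^ (N + 1)"
      by (simp add: real_sqrt_mult)
    finally show "2 / 5 / a - sqrt ?L \<le>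
      - sqrt (warp (m a) \<kappa> N 1) + sqrt (warp (m a) \<kappa> N 2) / 2 * 2 ^ (N + 1)"
      using 1 by (simp add: field_simps)
  qed
qed

text \<open>On the interval \<kappa> r^(N+2) is at most 2^(N+2) |\<kappa>|, so r^N F(r) is at least
  1 / a^2. The second claim is the case r = 1, which drives the minimum of the mean curvature to
  minus infinity.\<close>

lemma warp_pos:
  fixes a \<kappa> r :: real
  assumes "a > 0" "1 \<le> r" "r \<le> 2"
  shows "warp (1 / a\<^sup>2 + 2 ^ (N + 2) * \<bar>\<kappa>\<bar>) \<kappa> N r > 0"
    and "warp (1 / a\<^sup>2 + 2 ^ (N + 2) * \<bar>\<kappa>\<bar>) \<kappa> N 1 \<ge> 1 / a\<^sup>2"
proof -
  have "r ^ (N + 2) * \<kappa> \<le> 2 ^ (N + 2) * \<bar>\<kappa>\<bar>" if "1 \<le> r" "r \<le> 2" for r :: real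
    using that by (intro order_trans[OF mult_left_mono[OF abs_ge_self] mult_right_mono] power_mono) auto
  note * = this
  show "warp (1 / a\<^sup>2 + 2 ^ (N + 2) * \<bar>\<kappa>\<bar>) \<kappa> N 1 \<ge> 1 / a\<^sup>2"
    using *[of 1] by (simp add: warp_def)
  have "warp (1 / a\<^sup>2 + 2 ^ (N + 2) * \<bar>\<kappa>\<bar>) \<kappa> N r =
      (1 / a\<^sup>2 + 2 ^ (N + 2) * \<bar>\<kappa>\<bar> - r ^ (N + 2) * \<kappa>) / r ^ N"
    using assms by (simp add: warp_def diff_divide_distrib power_add power2_eq_square)
  moreover have "1 / a\<^sup>2 > 0" using assms by simp
  then have "1 / a\<^sup>2 + 2 ^ (N + 2) * \<bar>\<kappa>\<bar> - r ^ (N + 2) * \<kappa> > 0"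
    using *[OF assms(2,3)] by linarith
  moreover have "r ^ N > 0" using assms by simp
  ultimately show "warp (1 / a\<^sup>2 + 2 ^ (N + 2) * \<bar>\<kappa>\<bar>) \<kappa> N r > 0"
    by (simp only: divide_pos_pos)
qed

lemma constant_scalar_curvature_family:
  fixes C :: real
  assumes card: "CARD('n::finite) \<ge> 3"
  shows "\<exists>(T :: (nat \<Rightarrow> real) topology) (A :: (nat \<Rightarrow> real, 'n) chart set)
        (g :: real \<Rightarrow> (nat \<Rightarrow> real, 'n) metric).
        spin_manifold T A \<and> compact_space T \<and> connected_space T \<and> boundary A \<noteq> {} \<and>
        (\<forall>a>0. riemannian_metric A (g a)) \<and>
        (\<forall>a>0. \<forall>p\<in>topspace T. scalar_curvature A (g a) p = C) \<and>
        (\<forall>a>0. \<forall>a'>0. \<forall>c\<in>A. \<forall>p\<in>boundary A \<inter> cdom c.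
           boundary_metric (g a) c p = boundary_metric (g a') c p) \<and>
        filterlim (\<lambda>a. \<integral>p. mean_curvature A (g a) p \<partial>boundary_volume T A (g a)) at_top (at_right 0) \<and>
        filterlim (\<lambda>a. INF p\<in>boundary A. mean_curvature A (g a) p) at_bot (at_right 0)"
proof -
  define n where "n = real CARD('n)"
  define N where "N = CARD('n) - 2"
  \<comment> \<open>Chosen so that the scalar curvature n (n - 1) \<kappa> equals
    \<open>C\<close>.\<close>
  define \<kappa> where "\<kappa> = C / (n * (n - 1))"
  define m where "m = (\<lambda>a::real. 1 / a\<^sup>2 + 2 ^ (N + 2) * \<bar>\<kappa>\<bar>)"
  define g :: "real \<Rightarrow> (nat \<Rightarrow> real, 'n) metric" where "g = (\<lambda>a. warped_metric (m a) \<kappa>)"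
  let ?A = "slab_atlas :: (nat \<Rightarrow> real, 'n) chart set" and ?T = "slab_top TYPE('n)"
  have n: "n \<ge> 3" using card by (simp add: n_def)
  have N: "N \<ge> 1" "CARD('n) - 1 = N + 1" using card by (auto simp: N_def)
  have pos: "warp (m a) \<kappa> (CARD('n) - 2) r > 0" if "a > 0" "1 \<le> r" "r \<le> 2" for a r
    using warp_pos(1)[OF that] by (simp add: m_def N_def)
  \<comment> \<open>The mean curvature as a function of the radius; on the boundary the second case
    means radius 2.\<close>
  define hm where "hm = (\<lambda>a r::real. if r = 1 then - ((n - 1) * sqrt (warp (m a) \<kappa> N 1))
      else (n - 1) * sqrt (warp (m a) \<kappa> N 2) / 2)"
  have H: "mean_curvature ?A (g a) p = hm a (Re (cpt p (nix :: 'n)))" if "a > 0" "p \<in> boundary ?A" for a p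
    using mean_curvature_warped_metric[OF card pos[OF that(1)] that(2)]
    unfolding g_def hm_def n_def N_def by (simp only: minus_mult_left)
  have scal: "scalar_curvature ?A (g a) p = C" if "a > 0" "p \<in> topspace ?T" for a p
  proof -
    have "scalar_curvature ?A (g a) p = n * (n - 1) * \<kappa>"
      using scalar_curvature_warped_metric[OF card pos[OF that(1)], of p] that(2)
      by (simp add: g_def n_def slab_top_def)
    then show ?thesis using n by (simp add: \<kappa>_def)
  qed
  have "filterlim (\<lambda>a. \<integral>p. mean_curvature ?A (g a) p \<partial>boundary_volume ?T ?A (g a)) at_top (at_right 0)"
  proof -
    have "((\<integral>p. mean_curvature ?A (g a) p \<partial>boundary_volume ?T ?A (g a)) =
        ((n - 1) * (2 * pi) ^ (N + 1)) *
          (- sqrt (warp (m a) \<kappa> N 1) + sqrt (warp (m a) \<kappa> N 2) / 2 * 2 ^ (N + 1)))" if a: "a > 0" for a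
    proof -
      have "(\<integral>p. mean_curvature ?A (g a) p \<partial>boundary_volume ?T ?A (g a)) =
          (\<integral>p. mean_curvature ?A (g a) p \<partial>slab_boundary_measure TYPE('n))"
        by (simp add: g_def boundary_volume_slab)
      also have "\<dots> = (\<integral>p. hm a (Re (cpt p (nix :: 'n))) \<partial>slab_boundary_measure TYPE('n))"
        using H[OF a] by (intro Bochner_Integration.integral_cong refl)
          (simp add: slab_boundary_measure_def boundary_borel_def space_restrict_space)
      also have "\<dots> = (hm a 1 + hm a 2 * 2 ^ (N + 1)) * (2 * pi) ^ (N + 1)"
        unfolding integral_slab_boundary N(2) ..
      also have "\<dots> = ((n - 1) * (2 * pi) ^ (N + 1)) *
          (- sqrt (warp (m a) \<kappa> N 1) + sqrt (warp (m a) \<kappa> N 2) / 2 * 2 ^ (N + 1))"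
      proof -
        have "(- (u * x) + u * y / 2 * z) * w = u * w * (- x + y / 2 * z)" for u w x y z :: real
          by (simp add: field_simps)
        moreover have "hm a 1 = - ((n - 1) * sqrt (warp (m a) \<kappa> N 1))"
          "hm a 2 = (n - 1) * sqrt (warp (m a) \<kappa> N 2) / 2" by (simp_all add: hm_def)
        ultimately show ?thesis by (simp only:)
      qed
      finally show ?thesis .
    qed
    then have "\<forall>\<^sub>F a in at_right 0. ((n - 1) * (2 * pi) ^ (N + 1)) *
          (- sqrt (warp (m a) \<kappa> N 1) + sqrt (warp (m a) \<kappa> N 2) / 2 * 2 ^ (N + 1)) =
        (\<integral>p. mean_curvature ?A (g a) p \<partial>boundary_volume ?T ?A (g a))"
      by (intro eventually_at_right_less[THEN eventually_mono]) simp
    moreover have "filterlim (\<lambda>a. ((n - 1) * (2 * pi) ^ (N + 1)) *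
          (- sqrt (warp (m a) \<kappa> N 1) + sqrt (warp (m a) \<kappa> N 2) / 2 * 2 ^ (N + 1))) at_top (at_right 0)"
      unfolding m_def using n
      by (intro filterlim_tendsto_pos_mult_at_top[OF tendsto_const _ total_mean_curvature_limit[OF N(1)]]) simp
    ultimately show ?thesis by (rule filterlim_mono_eventually[OF _ order_refl order_refl, rotated])
  qed
  moreover have "filterlim (\<lambda>a. INF p\<in>boundary ?A. mean_curvature ?A (g a) p) at_bot (at_right 0)"
  proof (rule filterlim_at_bot_mono)
    show "filterlim (\<lambda>a::real. - (1 / a)) at_bot (at_right 0)" by real_asymp
    \<comment> \<open>A point of the end r = 1, where the mean curvature is negative, with all
      angles 0.\<close>
    define p where "p = end_point 1 (cis_map (\<lambda>_ :: 'n. 0))"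
    have p: "p \<in> boundary ?A" "Re (cpt p (nix :: 'n)) = 1"
      unfolding p_def using end_point_in_boundary[of 1 "\<lambda>_ :: 'n. 0"] by (simp_all add: end_point_def)
    show "\<forall>\<^sub>F a in at_right 0. (INF p\<in>boundary ?A. mean_curvature ?A (g a) p) \<le> - (1 / a)"
    proof (rule eventually_at_right_less[THEN eventually_mono])
      fix a :: real assume a: "0 < a"
      \<comment> \<open>A real infimum lies below each value only if the values are bounded below;
        here only two values occur.\<close>
      have "bdd_below ((\<lambda>p. mean_curvature ?A (g a) p) ` boundary ?A)"
        using H[OF a] by (intro bdd_belowI2[where m = "min (hm a 1) (hm a 2)"]) (auto simp: boundary_slab)
      then have "(INF p\<in>boundary ?A. mean_curvature ?A (g a) p) \<le> mean_curvature ?A (g a) p"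
        using p(1) by (rule cINF_lower)
      also have "\<dots> = - ((n - 1) * sqrt (warp (m a) \<kappa> N 1))" by (simp add: H[OF a p(1)] p(2) hm_def)
      also have "\<dots> \<le> - (1 / a)"
      proof -
        have "1 / a = sqrt (1 / a\<^sup>2)" using a by (simp add: real_sqrt_divide)
        also have "\<dots> \<le> sqrt (warp (m a) \<kappa> N 1)"
          using warp_pos(2)[of a 1 N \<kappa>] a by (intro real_sqrt_le_mono) (simp add: m_def)
        also have "\<dots> \<le> (n - 1) * sqrt (warp (m a) \<kappa> N 1)"
          using n pos[OF a, of 1] by (simp add: N_def)
        finally show ?thesis by simp
      qed
      finally show "(INF p\<in>boundary ?A. mean_curvature ?A (g a) p) \<le> - (1 / a)" .
    qed
  qed
  moreover have "boundary_metric (g a) c p = boundary_metric (g a') c p" for a a' c p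
    by (simp add: g_def boundary_metric_def warped_metric_def tangential_diagm)
  moreover have "riemannian_metric ?A (g a)" if "a > 0" for a
    unfolding g_def by (rule riemannian_warped_metric[OF card pos[OF that]])
  ultimately show ?thesis
    using spin_manifold_slab[where 'n = 'n] slab_compact[where 'n = 'n] slab_connected[where 'n = 'n]
      boundary_slab_nonempty[where 'n = 'n] scal
    by (intro exI[of _ ?T] exI[of _ ?A] exI[of _ g]) simp
qed


theorem theorem2:
  assumes "CARD('n::finite) \<ge> 3"
  shows
    "(\<exists>(T :: (nat \<Rightarrow> real) topology) (A :: (nat \<Rightarrow> real, 'n) chart set)
        (g :: real \<Rightarrow> (nat \<Rightarrow> real, 'n) metric).
        spin_manifold T A \<and> compact_space T \<and> connected_space T \<and> boundary A \<noteq> {} \<and>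
        (\<forall>a>0. riemannian_metric A (g a)) \<and>
        (\<forall>a>0. \<forall>p\<in>topspace T. scalar_curvature A (g a) p = 0) \<and>
        (\<forall>a>0. \<forall>a'>0. \<forall>c\<in>A. \<forall>p\<in>boundary A \<inter> cdom c.
           boundary_metric (g a) c p = boundary_metric (g a') c p) \<and>
        filterlim (\<lambda>a. \<integral>p. mean_curvature A (g a) p \<partial>boundary_volume T A (g a)) at_top (at_right 0) \<and>
        filterlim (\<lambda>a. INF p\<in>boundary A. mean_curvature A (g a) p) at_bot (at_right 0))
     \<and>
     (CARD('n) \<ge> 5 \<longrightarrow>
      (\<forall>C :: real.
       \<exists>(T :: (nat \<Rightarrow> real) topology) (A :: (nat \<Rightarrow> real, 'n) chart set)
        (g :: real \<Rightarrow> (nat \<Rightarrow> real, 'n) metric).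
        spin_manifold T A \<and> compact_space T \<and> connected_space T \<and> boundary A \<noteq> {} \<and>
        (\<forall>a>0. riemannian_metric A (g a)) \<and>
        (\<forall>a>0. \<forall>p\<in>topspace T. scalar_curvature A (g a) p = C) \<and>
        (\<forall>a>0. \<forall>a'>0. \<forall>c\<in>A. \<forall>p\<in>boundary A \<inter> cdom c.
           boundary_metric (g a) c p = boundary_metric (g a') c p) \<and>
        filterlim (\<lambda>a. \<integral>p. mean_curvature A (g a) p \<partial>boundary_volume T A (g a)) at_top (at_right 0) \<and>
        filterlim (\<lambda>a. INF p\<in>boundary A. mean_curvature A (g a) p) at_bot (at_right 0)))"
  \<comment> \<open>The first half is the case C = 0, and the second keeps \<open>C\<close>
    arbitrary.\<close>
  by (intro conjI impI allI) (rule constant_scalar_curvature_family[OF assms])+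

end
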